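(* Let $\{\mathbf{v}(\mathbf{x}), p(\mathbf{x})\}$ be a solution of the modified Darcy--Forchheimer boundary value problem $$\alpha(\mathbf{v}(\mathbf{x}),p(\mathbf{x}),\mathbf{x})\,\mathbf{v}(\mathbf{x}) + \mathrm{grad}[p(\mathbf{x})] = \rho\,\mathbf{b}(\mathbf{x}) \ \text{ in } \Omega, \qquad \mathrm{div}[\mathbf{v}(\mathbf{x})] = 0 \ \text{ in } \Omega, \qquad \mathbf{v}(\mathbf{x})\cdot\hat{\mathbf{n}}(\mathbf{x}) = v_n(\mathbf{x}) \ \text{ on } \partial\Omega,$$ where the body force is conservative, i.e. $\rho\,\mathbf{b}(\mathbf{x}) = \mathrm{grad}[\phi(\mathbf{x})]$ for some scalar potential field $\phi$ on $\Omega$. Then every kinematically admissible vector field $\widetilde{\mathbf{v}}:\Omega\to\mathbb{R}^{nd}$ satisfies $$\int_{\Omega} \alpha(\mathbf{v}(\mathbf{x}),p(\mathbf{x}),\mathbf{x})\,\mathbf{v}(\mathbf{x})\cdot\mathbf{v}(\mathbf{x})\;\mathrm{d}\Omega \;\leq\; \int_{\Omega} \alpha(\mathbf{v}(\mathbf{x}),p(\mathbf{x}),\mathbf{x})\,\widetilde{\mathbf{v}}(\mathbf{x})\cdot\widetilde{\mathbf{v}}(\mathbf{x})\;\mathrm{d}\Omega .$$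
   Context: $\Omega\subset\mathbb{R}^{nd}$ is an open bounded set, $nd$ is the number of spatial dimensions, and the boundary $\partial\Omega=\overline{\Omega}\setminus\Omega$ is piecewise smooth with unit outward normal $\hat{\mathbf{n}}(\mathbf{x})$. The field $\mathbf{v}:\Omega\to\mathbb{R}^{nd}$ is the (Darcy) velocity, $p:\Omega\to\mathbb{R}$ is the pressure, $\rho$ is the (constant) density, $\mathbf{b}$ is the specific body force, and $v_n$ is the prescribed normal component of the velocity, which is prescribed on the entire boundary (there is no part of the boundary where the pressure is prescribed). The drag coefficient of the modified Darcy--Forchheimer model is $$\alpha(\mathbf{v},p,\mathbf{x}) = \frac{\mu_0}{k(\mathbf{x})}\exp[\beta_{\mathrm{B}}\,p] + \beta_{\mathrm{F}}\,\|\mathbf{v}\|,$$ where $\mu_0>0$ is a constant, $k(\mathbf{x})>0$ is the permeability, $\beta_{\mathrm{B}}$ is the (constant) Barus coefficient, $\beta_{\mathrm{F}}\geq 0$ is the (constant) Forchheimer coefficient, and $\|\cdot\|$ is the Euclidean norm. In particular $\alpha>0$. A vector field $\widetilde{\mathbf{v}}:\Omega\to\mathbb{R}^{nd}$ is called kinematically admissible if (i) $\mathrm{div}[\widetilde{\mathbf{v}}(\mathbf{x})]=0$ in $\Omega$, and (ii) $\widetilde{\mathbf{v}}(\mathbf{x})\cdot\hat{\mathbf{n}}(\mathbf{x})=v_n(\mathbf{x})$ on $\partial\Omega$. It need not satisfy the balance of linear momentum (the first equation of the boundary value problem). All fields and the domain are understood to be regular enough that the integrals above exist and the divergence theorem (Green's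 identity) applies to them. *)

theory Defs
  imports "HOL-Analysis.Analysis"
begin

definition grad :: "('a::euclidean_space \<Rightarrow> real) \<Rightarrow> 'a \<Rightarrow> 'a" where
  "grad f x = (\<Sum>b\<in>Basis. frechet_derivative f (at x) b *\<^sub>R b)"

definition divergence :: "('a::euclidean_space \<Rightarrow> 'a) \<Rightarrow> 'a \<Rightarrow> real" where
  "divergence F x = (\<Sum>b\<in>Basis. frechet_derivative F (at x) b \<bullet> b)"

definition C1_on :: "'a::real_normed_vector set \<Rightarrow> ('a \<Rightarrow> 'b::real_normed_vector) \<Rightarrow> bool" where
  "C1_on U f \<longleftrightarrow> (\<exists>f'. (\<forall>x\<in>U. (f has_derivative blinfun_apply (f' x)) (at x)) \<and> continuous_on U f')"

text \<open>
  Regularity of the fields of the boundary value problem: continuously differentiable in the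
  open set \<open>\<Omega>\<close> and continuous up to the boundary. Fields are total functions; only their values
  on the closure of \<open>\<Omega>\<close> matter, and continuity on the closure makes the values on the boundary
  the boundary values of the field.
\<close>

definition regular_field :: "'a::real_normed_vector set \<Rightarrow> ('a \<Rightarrow> 'b::real_normed_vector) \<Rightarrow> bool" where
  "regular_field \<Omega> f \<longleftrightarrow> C1_on \<Omega> f \<and> continuous_on (closure \<Omega>) f"

text \<open>
  Near a smooth boundary point, \<open>\<Omega>\<close> is the sublevel set \<open>g < 0\<close> of a \<open>C\<^sup>1\<close> function with
  nonvanishing gradient, and the outward normal is the normalised gradient.
\<close>

definition outward_unit_normal :: "'a::euclidean_space set \<Rightarrow> 'a \<Rightarrow> 'a \<Rightarrow> bool" where
  "outward_unit_normal \<Omega> x \<nu> \<longleftrightarrow> x \<in> frontier \<Omega> \<and>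
     (\<exists>U g. open U \<and> x \<in> U \<and> C1_on U g \<and> grad g x \<noteq> 0 \<and>
        \<Omega> \<inter> U = {y \<in> U. g y < 0} \<and> \<nu> = grad g x /\<^sub>R norm (grad g x))"

definition smooth_boundary :: "'a::euclidean_space set \<Rightarrow> 'a set" where
  "smooth_boundary \<Omega> = {x. \<exists>\<nu>. outward_unit_normal \<Omega> x \<nu>}"

text \<open>
  The remaining boundary points (edges, corners, \<dots>) form a null set for the surface measure.
  For the boundary of a bounded set they form a compact set, so finite covers suffice.
  In dimension 1 the condition says that there are no such points.
\<close>

definition surface_null :: "'a::euclidean_space set \<Rightarrow> bool" where
  "surface_null S \<longleftrightarrow> (\<forall>e>0. \<exists>C :: ('a \<times> real) set. finite C \<and> (\<forall>(c, r)\<in>C. 0 < r) \<and>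
     S \<subseteq> (\<Union>(c, r)\<in>C. ball c r) \<and> (\<Sum>(c, r)\<in>C. r ^ (DIM('a) - 1)) < e)"

definition piecewise_smooth_boundary :: "'a::euclidean_space set \<Rightarrow> bool" where
  "piecewise_smooth_boundary \<Omega> \<longleftrightarrow> surface_null (frontier \<Omega> - smooth_boundary \<Omega>)"

definition drag ::
  "real \<Rightarrow> ('a \<Rightarrow> real) \<Rightarrow> real \<Rightarrow> real \<Rightarrow> 'a::euclidean_space \<Rightarrow> real \<Rightarrow> 'a \<Rightarrow> real" where
  "drag \<mu>\<^sub>0 k \<beta>\<^sub>B \<beta>\<^sub>F v p x = \<mu>\<^sub>0 / k x * exp (\<beta>\<^sub>B * p) + \<beta>\<^sub>F * norm v"

text \<open>The normal field \<open>n\<close> exists only on the smooth part of the boundary, so the condition on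
  the normal component is imposed there.\<close>

definition kinematically_admissible ::
  "'a::euclidean_space set \<Rightarrow> ('a \<Rightarrow> 'a) \<Rightarrow> ('a \<Rightarrow> real) \<Rightarrow> ('a \<Rightarrow> 'a) \<Rightarrow> bool" where
  "kinematically_admissible \<Omega> n v\<^sub>n w \<longleftrightarrow>
     (\<forall>x\<in>\<Omega>. divergence w x = 0) \<and> (\<forall>x\<in>smooth_boundary \<Omega>. w x \<bullet> n x = v\<^sub>n x)"

definition darcy_forchheimer_solution ::
  "'a::euclidean_space set \<Rightarrow> ('a \<Rightarrow> 'a) \<Rightarrow> ('a \<Rightarrow> real \<Rightarrow> 'a \<Rightarrow> real) \<Rightarrow> real \<Rightarrow> ('a \<Rightarrow> 'a) \<Rightarrow>
   ('a \<Rightarrow> real) \<Rightarrow> ('a \<Rightarrow> 'a) \<Rightarrow> ('a \<Rightarrow> real) \<Rightarrow> bool" where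
  "darcy_forchheimer_solution \<Omega> n \<alpha> \<rho> b v\<^sub>n v p \<longleftrightarrow>
     (\<forall>x\<in>\<Omega>. \<alpha> (v x) (p x) x *\<^sub>R v x + grad p x = \<rho> *\<^sub>R b x) \<and>
     (\<forall>x\<in>\<Omega>. divergence v x = 0) \<and>
     (\<forall>x\<in>smooth_boundary \<Omega>. v x \<bullet> n x = v\<^sub>n x)"

end

theory Submission
  imports Defs
begin

text \<open>
  Write \<open>u = w - v\<close> and \<open>q = \<phi> - p\<close>. The momentum balance says \<open>grad q = \<alpha> v\<close>, and completing
  the square gives, pointwise,
  \<open>\<alpha> w \<bullet> w - \<alpha> v \<bullet> v = \<alpha> u \<bullet> u + 2 \<alpha> v \<bullet> u \<ge> 2 grad q \<bullet> u\<close>.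
  Both velocities are solenoidal with the same normal component, so \<open>u\<close> is solenoidal and tangential
  to the boundary, and \<open>grad q \<bullet> u\<close> is the divergence of the tangential field \<open>F = q u\<close>. Everything
  thus rests on the divergence theorem for tangential fields, \<open>integral_divergence_eq_0\<close>: the
  divergence of such an \<open>F\<close> has integral zero.

  Since the boundary flux vanishes, the behaviour near the boundary reduces to estimates of volume
  integrals over thin strips. For a \<open>C1\<close> test function \<open>\<psi>\<close> consider the functional
  \<open>\<integral>\<^sub>\<Omega> \<psi> div F + F \<bullet> grad \<psi>\<close>, the integral over \<open>\<Omega>\<close> of \<open>div (\<psi> F)\<close>.

  It vanishes if \<open>\<psi>\<close> has compact support in \<open>\<Omega>\<close>, since the integral of a directional derivative of
  a compactly supported function is zero by translation invariance.

  It vanishes if \<open>\<psi>\<close> is supported near a smooth boundary point, where \<open>\<Omega>\<close> is \<open>g < 0\<close>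
  (\<open>locally_null_boundary\<close>). Multiply \<open>\<psi>\<close> by a cutoff in \<open>g\<close> that drops from 1 to 0 for \<open>g\<close>
  between \<open>-2\<delta>\<close> and \<open>-\<delta>\<close>; the error is the integral over this strip of a multiple of
  \<open>F \<bullet> grad g / \<delta>\<close>. The strip has measure \<open>O(\<delta>)\<close> (\<open>level_strip_measure_le\<close>), because about \<open>1/\<delta>\<close>
  translates of it along the normal direction are disjoint, and \<open>F \<bullet> grad g\<close> is uniformly small on
  it, because it is continuous and vanishes on the boundary.

  A finite cover then gives the claim for every \<open>\<psi>\<close> that vanishes near the edges of the boundary.
  Finally, in dimension \<open>d\<close>, the edges are covered by balls of radii \<open>r\<close> with a small sum of the
  powers \<open>r ^ (d - 1)\<close>. A cutoff that removes a ball has gradient \<open>O(1/r)\<close> on a set of measure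
  \<open>O(r ^ d)\<close>, so the error that it causes is small too (\<open>cutoff_around_edges\<close>).
\<close>
section \<open>Cutoff functions of class C1\<close>

lemma DERIV_square_max_0:
  "((\<lambda>s::real. (max 0 s)\<^sup>2) has_real_derivative 2 * max 0 s) (at s)"
proof -
  consider "s < 0" | "s = 0" | "s > 0" by linarith
  then show ?thesis
  proof cases
    case 1
    have "((\<lambda>s::real. 0) has_real_derivative 0) (at s)" by simp
    then have "((\<lambda>s::real. (max 0 s)\<^sup>2) has_real_derivative 0) (at s)"
      by (rule DERIV_cong_ev[OF refl _ refl, THEN iffD1, rotated])
        (use 1 in \<open>auto simp: eventually_nhds intro!: exI[of _ "{..<0}"]\<close>)
    then show ?thesis using 1 by simp
  next
    case 2
    have "((\<lambda>h::real. max 0 h) \<longlongrightarrow> max 0 0) (at 0)"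
      by (intro tendsto_intros)
    moreover have "\<forall>\<^sub>F h::real in at 0. max 0 h = ((max 0 (0 + h))\<^sup>2 - (max 0 0)\<^sup>2) / h"
      by (auto simp: eventually_at_filter max_def power2_eq_square)
    ultimately have "((\<lambda>h::real. ((max 0 (0 + h))\<^sup>2 - (max 0 0)\<^sup>2) / h) \<longlongrightarrow> max 0 0) (at 0)"
      by (rule Lim_transform_eventually)
    then show ?thesis using 2 by (simp add: DERIV_def)
  next
    case 3
    have "((\<lambda>s::real. s\<^sup>2) has_real_derivative 2 * s) (at s)"
      by (auto intro!: derivative_eq_intros)
    then have "((\<lambda>s::real. (max 0 s)\<^sup>2) has_real_derivative 2 * s) (at s)"
      by (rule DERIV_cong_ev[OF refl _ refl, THEN iffD1, rotated])
        (use 3 in \<open>auto simp: eventually_nhds intro!: exI[of _ "{0<..}"]\<close>)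
    then show ?thesis using 3 by simp
  qed
qed

text \<open>
  A \<open>C1\<close> transition from 0 on the negative half-line to 1 beyond 1. Composing the \<open>C1\<close> function
  \<open>s \<mapsto> (max 0 s)\<^sup>2\<close> with a reflected copy of itself avoids gluing derivatives at 0 and 1.
\<close>
definition smooth_step :: "real \<Rightarrow> real" where
  "smooth_step s = 1 - (max 0 (1 - (max 0 s)\<^sup>2))\<^sup>2"

definition smooth_step' :: "real \<Rightarrow> real" where
  "smooth_step' s = 4 * max 0 (1 - (max 0 s)\<^sup>2) * max 0 s"

lemma DERIV_smooth_step: "(smooth_step has_real_derivative smooth_step' s) (at s)"
proof -
  have inner: "((\<lambda>s. 1 - (max 0 s)\<^sup>2) has_real_derivative - (2 * max 0 s)) (at s)"
    using DERIV_diff[OF DERIV_const[of 1] DERIV_square_max_0] by simp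
  have "((\<lambda>s. (max 0 (1 - (max 0 s)\<^sup>2))\<^sup>2) has_real_derivative
      2 * max 0 (1 - (max 0 s)\<^sup>2) * - (2 * max 0 s)) (at s)"
    by (rule DERIV_chain2[OF DERIV_square_max_0 inner])
  from DERIV_diff[OF DERIV_const[of 1] this] show ?thesis
    unfolding smooth_step_def[abs_def] smooth_step'_def by (simp add: mult_ac)
qed

lemma continuous_on_smooth_step': "continuous_on A smooth_step'"
  unfolding smooth_step'_def[abs_def] by (intro continuous_intros)

lemma continuous_on_smooth_step: "continuous_on A smooth_step"
  unfolding smooth_step_def[abs_def] by (intro continuous_intros)

lemma smooth_step_nonpos: "s \<le> 0 \<Longrightarrow> smooth_step s = 0" "s \<le> 0 \<Longrightarrow> smooth_step' s = 0"
  by (auto simp: smooth_step_def smooth_step'_def max_def)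

lemma smooth_step_ge_1:
  assumes "s \<ge> 1"
  shows "smooth_step s = 1" "smooth_step' s = 0"
proof -
  have "1\<^sup>2 \<le> s\<^sup>2" using assms by (intro power_mono) auto
  moreover have "max 0 s = s" using assms by simp
  ultimately have "max 0 (1 - (max 0 s)\<^sup>2) = 0" by simp
  then show "smooth_step s = 1" "smooth_step' s = 0"
    by (simp_all only: smooth_step_def smooth_step'_def) simp_all
qed

lemma smooth_step_bounds: "0 \<le> smooth_step s" "smooth_step s \<le> 1"
proof -
  have "(max 0 (1 - (max 0 s)\<^sup>2))\<^sup>2 \<le> 1\<^sup>2"
    by (intro power_mono) simp_all
  then show "0 \<le> smooth_step s"
    unfolding smooth_step_def by simp
  show "smooth_step s \<le> 1"
    unfolding smooth_step_def using zero_le_power2[of "max 0 (1 - (max 0 s)\<^sup>2)"] by linarith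
qed

lemma smooth_step'_bounds: "0 \<le> smooth_step' s" "smooth_step' s \<le> 4"
proof -
  show "0 \<le> smooth_step' s" by (simp add: smooth_step'_def)
  show "smooth_step' s \<le> 4"
  proof (cases "s \<ge> 1")
    case True then show ?thesis by (simp add: smooth_step_ge_1)
  next
    case False
    then have "max 0 (1 - (max 0 s)\<^sup>2) * max 0 s \<le> 1 * 1"
      by (intro mult_mono) auto
    then show ?thesis by (simp add: smooth_step'_def)
  qed
qed

text \<open>
  The argument of the step runs from 0 on the sphere of radius \<open>r\<close> to 1 on the sphere of radius
  \<open>2 * r\<close>. Taking the squared distance keeps the function differentiable at the centre.
\<close>
definition cutoff :: "'a::euclidean_space \<Rightarrow> real \<Rightarrow> 'a \<Rightarrow> real" where
  "cutoff c r x = 1 - smooth_step (((x - c) \<bullet> (x - c) / r\<^sup>2 - 1) / 3)"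

definition cutoff' :: "'a::euclidean_space \<Rightarrow> real \<Rightarrow> 'a \<Rightarrow> 'a" where
  "cutoff' c r x = - (smooth_step' (((x - c) \<bullet> (x - c) / r\<^sup>2 - 1) / 3) * (2 / (3 * r\<^sup>2))) *\<^sub>R (x - c)"

lemma GDERIV_cutoff: "GDERIV (cutoff c r) x :> cutoff' c r x"
proof -
  let ?q = "\<lambda>x. ((x - c) \<bullet> (x - c) / r\<^sup>2 - 1) / 3"
  have q: "GDERIV ?q x :> (2 / (3 * r\<^sup>2)) *\<^sub>R (x - c)"
  proof -
    have sq: "GDERIV (\<lambda>x. (x - c) \<bullet> (x - c)) x :> 2 *\<^sub>R (x - c)"
      unfolding gderiv_def
      by (auto intro!: derivative_eq_intros ext simp: inner_commute)
    have "((\<lambda>t. (t / r\<^sup>2 - 1) / 3) has_real_derivative 1 / (3 * r\<^sup>2)) (at t)" for t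
      using DERIV_cdivide[OF DERIV_diff[OF DERIV_cdivide[OF DERIV_ident, of "r\<^sup>2"] DERIV_const[of 1]], of 3]
      by (simp add: mult.commute)
    from GDERIV_DERIV_compose[OF sq this] show ?thesis by simp
  qed
  have "GDERIV (\<lambda>x. 1 - smooth_step (?q x)) x :> 0 - smooth_step' (?q x) *\<^sub>R ((2 / (3 * r\<^sup>2)) *\<^sub>R (x - c))"
    by (intro GDERIV_diff GDERIV_const GDERIV_DERIV_compose[OF q DERIV_smooth_step])
  then show ?thesis
    by (simp add: cutoff_def[abs_def] cutoff'_def)
qed

lemma continuous_on_cutoff': "continuous_on A (cutoff' c r)"
proof -
  have "continuous_on A (\<lambda>x. smooth_step' (((x - c) \<bullet> (x - c) / r\<^sup>2 - 1) / 3))"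
    unfolding divide_inverse
    by (intro continuous_on_compose2[OF continuous_on_smooth_step'[of UNIV]] continuous_intros) simp
  then show ?thesis
    unfolding cutoff'_def[abs_def] by (intro continuous_intros)
qed

lemma cutoff_bounds: "0 \<le> cutoff c r x" "cutoff c r x \<le> 1"
  by (simp_all add: cutoff_def smooth_step_bounds)

lemma cutoff_near:
  assumes "r > 0" "dist c x \<le> r"
  shows "cutoff c r x = 1"
proof -
  have "(norm (x - c))\<^sup>2 \<le> r\<^sup>2"
    using assms by (intro power_mono) (auto simp: dist_norm norm_minus_commute)
  then have "(x - c) \<bullet> (x - c) \<le> r\<^sup>2"
    by (simp only: power2_norm_eq_inner)
  then have "((x - c) \<bullet> (x - c) / r\<^sup>2 - 1) / 3 \<le> 0"
    using assms by (simp add: divide_le_eq)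
  then show ?thesis by (simp add: cutoff_def smooth_step_nonpos)
qed

lemma cutoff_far:
  assumes "r > 0" "dist c x \<ge> 2 * r"
  shows "cutoff c r x = 0" "cutoff' c r x = 0"
proof -
  have "(2 * r)\<^sup>2 \<le> (norm (x - c))\<^sup>2"
    using assms by (intro power_mono) (auto simp: dist_norm norm_minus_commute)
  then have "(x - c) \<bullet> (x - c) \<ge> 4 * r\<^sup>2"
    by (simp only: power2_norm_eq_inner power_mult_distrib) simp
  then have "((x - c) \<bullet> (x - c) / r\<^sup>2 - 1) / 3 \<ge> 1"
    using assms by (simp add: le_divide_eq)
  then show "cutoff c r x = 0" "cutoff' c r x = 0"
    by (simp_all add: cutoff_def cutoff'_def smooth_step_ge_1)
qed

text \<open>
  The bound \<open>O(1/r)\<close> makes the total variation of the cutoff of the order of the surface of the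
  ball, which is what the definition of a null set for the surface measure controls.
\<close>
lemma norm_cutoff'_le:
  assumes "r > 0"
  shows "norm (cutoff' c r x) \<le> 6 / r * indicator (ball c (2 * r)) x"
proof (cases "dist c x \<ge> 2 * r")
  case True
  then show ?thesis using cutoff_far(2)[OF assms True] by simp
next
  case False
  let ?s = "smooth_step' (((x - c) \<bullet> (x - c) / r\<^sup>2 - 1) / 3)"
  have "norm (cutoff' c r x) = ?s * (2 / (3 * r\<^sup>2)) * norm (x - c)"
    using smooth_step'_bounds(1)[of "((x - c) \<bullet> (x - c) / r\<^sup>2 - 1) / 3"] by (simp add: cutoff'_def abs_mult)
  also have "\<dots> \<le> 4 * (2 / (3 * r\<^sup>2)) * (2 * r)"
    using False smooth_step'_bounds
    by (intro mult_mono) (auto simp: dist_norm norm_minus_commute)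
  also have "\<dots> \<le> 6 / r"
    using assms by (simp add: field_simps power2_eq_square)
  finally show ?thesis using False by simp
qed

section \<open>Integrals of derivatives of compactly supported functions\<close>

lemma has_derivative_locally_zero:
  fixes f :: "'a::real_normed_vector \<Rightarrow> 'b::real_normed_vector"
  assumes "(f has_derivative f') (at x)" "open S" "x \<in> S" "\<And>y. y \<in> S \<Longrightarrow> f y = 0"
  shows "f' = (\<lambda>h. 0)"
proof -
  have "((\<lambda>y. 0) has_derivative f') (at x)"
    using has_derivative_transform_within_open[OF assms(1-3), of "\<lambda>y. 0"] assms(4) by auto
  then show ?thesis
    by (rule has_derivative_unique) auto
qed

text \<open>
  The difference quotients of \<open>f\<close> in direction \<open>b\<close> have integral zero by translation invariance of
  the Lebesgue measure. They converge boundedly, with supports in a fixed ball, to the directional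
  derivative.
\<close>
lemma integral_directional_derivative_eq_0:
  fixes f :: "'a::euclidean_space \<Rightarrow> real"
  assumes der: "\<And>x. (f has_derivative f' x) (at x)"
    and cont: "continuous_on UNIV (\<lambda>x. f' x b)"
    and supp: "\<And>x. x \<notin> cball 0 R \<Longrightarrow> f x = 0"
  shows "integrable lborel (\<lambda>x. f' x b)" "(LINT x|lborel. f' x b) = 0"
proof -
  let ?q = "\<lambda>m x. (f (x + (1 / Suc m) *\<^sub>R b) - f x) / (1 / real (Suc m))"
  have contf: "continuous_on UNIV f"
    by (intro continuous_at_imp_continuous_on ballI has_derivative_continuous[OF der])
  have zero: "f' x b = 0" if "x \<notin> cball 0 R" for x
    using has_derivative_locally_zero[OF der[of x], of "- cball 0 R"] supp that by (simp add: open_Compl)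
  obtain M where M: "\<And>x. \<bar>f' x b\<bar> \<le> M"
  proof -
    have "compact ((\<lambda>x. f' x b) ` cball 0 R)"
      by (intro compact_continuous_image continuous_on_subset[OF cont]) auto
    then obtain M where "\<forall>y\<in>(\<lambda>x. f' x b) ` cball 0 R. norm y \<le> M"
      using compact_imp_bounded bounded_iff by blast
    then have "\<bar>f' x b\<bar> \<le> max M 0" for x
      by (cases "x \<in> cball 0 R") (auto simp: zero intro: max.coboundedI1)
    then show ?thesis using that by blast
  qed
  have line: "((\<lambda>t. f (x + t *\<^sub>R b)) has_real_derivative f' (x + t *\<^sub>R b) b) (at t)" for x t
  proof -
    have "((\<lambda>t. x + t *\<^sub>R b) has_derivative (\<lambda>h. h *\<^sub>R b)) (at t)"
      by (auto intro!: derivative_eq_intros)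
    from has_derivative_compose[OF this der]
    have "((\<lambda>t. f (x + t *\<^sub>R b)) has_derivative (\<lambda>h. f' (x + t *\<^sub>R b) (h *\<^sub>R b))) (at t)" .
    moreover have "f' (x + t *\<^sub>R b) (h *\<^sub>R b) = f' (x + t *\<^sub>R b) b * h" for h
      using linear_cmul[OF has_derivative_linear[OF der]] by auto
    ultimately show ?thesis
      by (simp add: has_field_derivative_def)
  qed
  have q_le: "\<bar>?q m x\<bar> \<le> M * indicator (cball 0 (R + norm b)) x" for m x
  proof (cases "x \<in> cball 0 (R + norm b)")
    case True
    have "\<exists>z>0. z < 1 / Suc m \<and>
      f (x + (1 / Suc m) *\<^sub>R b) - f (x + 0 *\<^sub>R b) = (1 / Suc m - 0) * f' (x + z *\<^sub>R b) b"
      by (rule MVT2) (use line in auto)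
    then obtain z where "f (x + (1 / Suc m) *\<^sub>R b) - f x = 1 / Suc m * f' (x + z *\<^sub>R b) b"
      by auto
    then have "?q m x = f' (x + z *\<^sub>R b) b"
      by (simp del: of_nat_Suc)
    then show ?thesis using M True by simp
  next
    case False
    have nx: "norm x > R + norm b" using False by simp
    have "norm ((1 / Suc m) *\<^sub>R b) \<le> norm b"
      by (simp add: divide_le_eq mult_le_cancel_left1)
    moreover have "norm (x + (1 / Suc m) *\<^sub>R b) \<ge> norm x - norm ((1 / Suc m) *\<^sub>R b)"
      by (metis norm_diff_ineq)
    ultimately have "norm (x + (1 / Suc m) *\<^sub>R b) > R" using nx by linarith
    moreover have "norm x > R" using nx norm_ge_zero[of b] by linarith
    ultimately have "f (x + (1 / Suc m) *\<^sub>R b) = 0" "f x = 0"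
      using supp by auto
    then show ?thesis using False by (simp del: of_nat_Suc)
  qed
  have fint: "integrable lborel f"
  proof -
    have "integrable lborel (\<lambda>x. indicator (cball 0 R) x *\<^sub>R f x)"
      by (intro borel_integrable_compact continuous_on_subset[OF contf]) auto
    moreover have "(\<lambda>x. indicator (cball 0 R) x *\<^sub>R f x) = f"
      using supp by (fastforce simp: indicator_def)
    ultimately show ?thesis by simp
  qed
  have fmeas[measurable]: "f \<in> borel_measurable borel"
    using contf by (rule borel_measurable_continuous_onI)
  have shift: "integrable lborel (\<lambda>x. f (x + c))" "(LINT x|lborel. f (x + c)) = (LINT x|lborel. f x)" for c
  proof -
    have "integrable (distr lborel borel ((+) c)) f"
      unfolding lborel_distr_plus by (rule fint)
    then show "integrable lborel (\<lambda>x. f (x + c))"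
      by (subst (asm) integrable_distr_eq) (auto simp: add.commute)
    have "(LINT x|lborel. f x) = (LINT x|distr lborel borel ((+) c). f x)"
      unfolding lborel_distr_plus ..
    also have "\<dots> = (LINT x|lborel. f (x + c))"
      by (subst integral_distr) (auto simp: add.commute)
    finally show "(LINT x|lborel. f (x + c)) = (LINT x|lborel. f x)" ..
  qed
  have q0: "(LINT x|lborel. ?q m x) = 0" for m
    using shift fint by simp
  have dmeas: "(\<lambda>x. f' x b) \<in> borel_measurable lborel"
    using borel_measurable_continuous_onI[OF cont] by simp
  have qmeas: "?q m \<in> borel_measurable lborel" for m
    by measurable
  have wint: "integrable lborel (\<lambda>x::'a. M * indicator (cball 0 (R + norm b)) x)"
    by (intro integrable_mult_right integrable_real_indicator emeasure_lborel_cball_finite) auto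
  have lim: "(\<lambda>m. ?q m x) \<longlonglongrightarrow> f' x b" for x
  proof -
    have "(\<lambda>h. (f (x + (0 + h) *\<^sub>R b) - f (x + 0 *\<^sub>R b)) / h) \<midarrow>0\<rightarrow> f' (x + 0 *\<^sub>R b) b"
      using line[of x 0] by (simp only: DERIV_def)
    moreover have "filterlim (\<lambda>m. 1 / real (Suc m)) (at 0) sequentially"
      using LIMSEQ_Suc[OF lim_1_over_n] by (auto simp: filterlim_at simp del: of_nat_Suc)
    ultimately have "(\<lambda>m. (f (x + (0 + 1 / real (Suc m)) *\<^sub>R b) - f (x + 0 *\<^sub>R b)) / (1 / real (Suc m)))
        \<longlonglongrightarrow> f' (x + 0 *\<^sub>R b) b"
      by (rule filterlim_compose)
    then show ?thesis by simp
  qed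
  have limAE: "AE x in lborel. (\<lambda>m. ?q m x) \<longlonglongrightarrow> f' x b"
    by (intro always_eventually allI lim)
  have bound: "AE x in lborel. norm (?q m x) \<le> M * indicator (cball 0 (R + norm b)) x" for m
    unfolding real_norm_def by (intro always_eventually allI q_le)
  have dom: "integrable lborel (\<lambda>x. f' x b)" "(\<lambda>m. LINT x|lborel. ?q m x) \<longlonglongrightarrow> (LINT x|lborel. f' x b)"
    by (rule integrable_dominated_convergence[OF dmeas qmeas wint limAE bound],
        rule integral_dominated_convergence[OF dmeas qmeas wint limAE bound])
  show "integrable lborel (\<lambda>x. f' x b)" by (rule dom(1))
  show "(LINT x|lborel. f' x b) = 0"
    using dom(2) unfolding q0 by (simp add: LIMSEQ_const_iff)
qed

text \<open>
  The local form: a function on \<open>W\<close> that vanishes off a compact subset extends by zero to a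
  function that is differentiable everywhere.
\<close>
lemma integral_directional_derivative_open_eq_0:
  fixes f :: "'a::euclidean_space \<Rightarrow> real"
  assumes "open W" "compact K" "K \<subseteq> W"
    and der: "\<And>x. x \<in> W \<Longrightarrow> (f has_derivative f' x) (at x)"
    and cont: "continuous_on W (\<lambda>x. f' x b)"
    and supp: "\<And>x. x \<in> W - K \<Longrightarrow> f x = 0"
  shows "integrable lborel (\<lambda>x. indicator W x * f' x b)" "(LINT x|lborel. indicator W x * f' x b) = 0"
proof -
  define h where "h x = (if x \<in> W then f x else 0)" for x
  define h' where "h' x = (if x \<in> W then f' x else (\<lambda>_. 0))" for x
  have oK: "open (- K)" using \<open>compact K\<close> compact_imp_closed by auto
  have zero: "f' x = (\<lambda>_. 0)" if "x \<in> W - K" for x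
    by (rule has_derivative_locally_zero[OF der, of x "W - K"])
      (use that supp \<open>open W\<close> oK in \<open>auto simp: Diff_eq\<close>)
  have 1: "(h has_derivative h' x) (at x)" for x
  proof (cases "x \<in> W")
    case True
    show ?thesis
      by (rule has_derivative_transform_within_open[of f _ _ _ W])
        (use True der \<open>open W\<close> in \<open>auto simp: h_def h'_def\<close>)
  next
    case False
    show ?thesis
      by (rule has_derivative_transform_within_open[of "\<lambda>_. 0" _ _ _ "- K"])
        (use False \<open>K \<subseteq> W\<close> oK supp in \<open>auto simp: h_def h'_def\<close>)
  qed
  have 2: "continuous_on UNIV (\<lambda>x. h' x b)"
  proof -
    have "continuous_on W (\<lambda>x. h' x b)"
      using cont by (rule continuous_on_eq) (auto simp: h'_def)
    moreover have "continuous_on (- K) (\<lambda>x. h' x b)"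
      by (rule continuous_on_eq[of _ "\<lambda>_. 0"]) (auto simp: h'_def zero)
    ultimately have "continuous_on (W \<union> - K) (\<lambda>x. h' x b)"
      using \<open>open W\<close> oK by (intro continuous_on_open_Un) auto
    moreover have "W \<union> - K = UNIV" using \<open>K \<subseteq> W\<close> by auto
    ultimately show ?thesis by simp
  qed
  obtain R where R: "\<forall>x\<in>K. norm x \<le> R"
    using compact_imp_bounded[OF \<open>compact K\<close>] bounded_iff by blast
  have 3: "h x = 0" if "x \<notin> cball 0 R" for x
    using that R supp by (auto simp: h_def)
  have eq: "(\<lambda>x. indicator W x * f' x b) = (\<lambda>x. h' x b)"
    by (auto simp: h'_def indicator_def fun_eq_iff)
  show "integrable lborel (\<lambda>x. indicator W x * f' x b)" "(LINT x|lborel. indicator W x * f' x b) = 0"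
    unfolding eq using integral_directional_derivative_eq_0[of h h' b R, OF 1 2 3] by auto
qed

section \<open>Gradient and divergence of continuously differentiable fields\<close>

lemma C1_on_derivative:
  assumes "C1_on U f"
  shows "x \<in> U \<Longrightarrow> (f has_derivative frechet_derivative f (at x)) (at x)"
    and "continuous_on U (\<lambda>x. frechet_derivative f (at x) d)"
proof -
  obtain f' where f': "\<And>x. x \<in> U \<Longrightarrow> (f has_derivative blinfun_apply (f' x)) (at x)" "continuous_on U f'"
    using assms by (auto simp: C1_on_def)
  have eq: "frechet_derivative f (at x) = blinfun_apply (f' x)" if "x \<in> U" for x
    using frechet_derivative_at[OF f'(1)[OF that]] by simp
  show "x \<in> U \<Longrightarrow> (f has_derivative frechet_derivative f (at x)) (at x)"
    using f'(1) eq by simp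
  have "continuous_on U (\<lambda>x. blinfun_apply (f' x) d)"
    by (intro continuous_intros f'(2))
  then show "continuous_on U (\<lambda>x. frechet_derivative f (at x) d)"
    by (rule continuous_on_eq) (simp add: eq)
qed

lemma C1_on_continuous:
  assumes "C1_on U f"
  shows "continuous_on U f"
  by (intro continuous_at_imp_continuous_on ballI has_derivative_continuous[OF C1_on_derivative(1)[OF assms]])

lemma C1_on_subset: "C1_on U f \<Longrightarrow> T \<subseteq> U \<Longrightarrow> C1_on T f"
  unfolding C1_on_def by (meson continuous_on_subset subsetD)

lemma C1_onI:
  fixes f :: "'a::euclidean_space \<Rightarrow> 'b::real_normed_vector"
  assumes der: "\<And>x. x \<in> U \<Longrightarrow> (f has_derivative f' x) (at x)"
    and cont: "\<And>b. b \<in> Basis \<Longrightarrow> continuous_on U (\<lambda>x. f' x b)"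
  shows "C1_on U f"
proof -
  have app: "blinfun_apply (Blinfun (f' x)) = f' x" if "x \<in> U" for x
    using der[OF that] by (intro bounded_linear_Blinfun_apply has_derivative_bounded_linear)
  have "continuous_on U (\<lambda>x. Blinfun (f' x))"
  proof (rule continuous_on_blinfun_componentwise)
    fix b :: 'a assume "b \<in> Basis"
    from cont[OF this] show "continuous_on U (\<lambda>x. blinfun_apply (Blinfun (f' x)) b)"
      by (rule continuous_on_eq) (simp add: app)
  qed
  then show ?thesis
    unfolding C1_on_def using der app by (intro exI[of _ "\<lambda>x. Blinfun (f' x)"]) simp
qed

lemma C1_on_scaleR:
  fixes q :: "'a::euclidean_space \<Rightarrow> real" and u :: "'a \<Rightarrow> 'b::real_normed_vector"
  assumes "C1_on U q" "C1_on U u"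
  shows "C1_on U (\<lambda>x. q x *\<^sub>R u x)"
proof (rule C1_onI)
  show "((\<lambda>x. q x *\<^sub>R u x) has_derivative
      (\<lambda>h. q x *\<^sub>R frechet_derivative u (at x) h + frechet_derivative q (at x) h *\<^sub>R u x)) (at x)"
    if "x \<in> U" for x
    using C1_on_derivative(1)[OF assms(1) that] C1_on_derivative(1)[OF assms(2) that]
    by (rule has_derivative_scaleR)
qed (intro continuous_intros C1_on_derivative(2) C1_on_continuous assms)

lemma C1_on_diff:
  fixes f g :: "'a::euclidean_space \<Rightarrow> 'b::real_normed_vector"
  assumes "C1_on U f" "C1_on U g"
  shows "C1_on U (\<lambda>x. f x - g x)"
proof (rule C1_onI)
  show "((\<lambda>x. f x - g x) has_derivative
      (\<lambda>h. frechet_derivative f (at x) h - frechet_derivative g (at x) h)) (at x)"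
    if "x \<in> U" for x
    using C1_on_derivative(1)[OF assms(1) that] C1_on_derivative(1)[OF assms(2) that]
    by (rule has_derivative_diff)
qed (intro continuous_intros C1_on_derivative(2) assms)

lemma regular_field_diff:
  fixes f g :: "'a::euclidean_space \<Rightarrow> 'b::real_normed_vector"
  assumes "regular_field U f" "regular_field U g"
  shows "regular_field U (\<lambda>x. f x - g x)"
  using assms by (auto simp: regular_field_def intro: C1_on_diff continuous_intros)

lemma regular_field_scaleR:
  fixes q :: "'a::euclidean_space \<Rightarrow> real" and u :: "'a \<Rightarrow> 'b::real_normed_vector"
  assumes "regular_field U q" "regular_field U u"
  shows "regular_field U (\<lambda>x. q x *\<^sub>R u x)"
  using assms by (auto simp: regular_field_def intro: C1_on_scaleR continuous_intros)

lemma has_derivative_inner_grad: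
  assumes "(f has_derivative f') (at x)"
  shows "f' h = h \<bullet> grad f x"
proof -
  interpret linear f' by (rule has_derivative_linear[OF assms])
  have "frechet_derivative f (at x) = f'"
    using frechet_derivative_at[OF assms] by simp
  then have "h \<bullet> grad f x = (\<Sum>b\<in>Basis. f' ((h \<bullet> b) *\<^sub>R b))"
    by (simp add: grad_def inner_sum_right scale mult.commute)
  also have "\<dots> = f' h"
    by (simp add: euclidean_representation flip: sum)
  finally show ?thesis ..
qed

lemma C1_on_GDERIV:
  assumes "C1_on U f" "x \<in> U"
  shows "GDERIV f x :> grad f x"
proof -
  have "(f has_derivative frechet_derivative f (at x)) (at x)"
    using assms by (rule C1_on_derivative)
  moreover from this have "frechet_derivative f (at x) = (\<lambda>h. h \<bullet> grad f x)"
    by (intro ext has_derivative_inner_grad)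
  ultimately show ?thesis by (simp add: gderiv_def)
qed

lemma GDERIV_imp_grad_eq:
  assumes "GDERIV f x :> D"
  shows "grad f x = D"
proof -
  have "h \<bullet> D = h \<bullet> grad f x" for h
    using has_derivative_inner_grad[OF assms[unfolded gderiv_def]] .
  then show ?thesis by (metis inner_commute vector_eq_ldot)
qed

lemma continuous_on_grad: "C1_on U f \<Longrightarrow> continuous_on U (grad f)"
  unfolding grad_def[abs_def] by (intro continuous_intros C1_on_derivative(2))

lemma continuous_on_divergence: "C1_on U F \<Longrightarrow> continuous_on U (divergence F)"
  unfolding divergence_def[abs_def] by (intro continuous_intros C1_on_derivative(2))

lemma grad_diff:
  assumes "C1_on U f" "C1_on U g" "x \<in> U"
  shows "grad (\<lambda>x. f x - g x) x = grad f x - grad g x"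
  by (intro GDERIV_imp_grad_eq GDERIV_diff C1_on_GDERIV[OF _ assms(3)] assms)

lemma divergence_diff:
  assumes "C1_on U F" "C1_on U G" "x \<in> U"
  shows "divergence (\<lambda>x. F x - G x) x = divergence F x - divergence G x"
proof -
  have "frechet_derivative (\<lambda>x. F x - G x) (at x) =
      (\<lambda>h. frechet_derivative F (at x) h - frechet_derivative G (at x) h)"
    using frechet_derivative_at[OF has_derivative_diff[OF C1_on_derivative(1)[OF assms(1,3)]
        C1_on_derivative(1)[OF assms(2,3)]]] by simp
  then show ?thesis
    by (simp add: divergence_def inner_diff_left sum_subtractf)
qed

lemma divergence_scaleR:
  assumes "C1_on U q" "C1_on U u" "x \<in> U"
  shows "divergence (\<lambda>x. q x *\<^sub>R u x) x = q x * divergence u x + u x \<bullet> grad q x"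
proof -
  have "frechet_derivative (\<lambda>x. q x *\<^sub>R u x) (at x) =
      (\<lambda>h. q x *\<^sub>R frechet_derivative u (at x) h + frechet_derivative q (at x) h *\<^sub>R u x)"
    using frechet_derivative_at[OF has_derivative_scaleR[OF C1_on_derivative(1)[OF assms(1,3)]
        C1_on_derivative(1)[OF assms(2,3)]]] by simp
  then show ?thesis
    by (simp add: divergence_def grad_def inner_add_left inner_sum_right sum.distrib sum_distrib_left)
qed

text \<open>
  The integrand is the divergence of \<open>\<theta> F\<close>; the preceding section applies to each of its
  components.
\<close>
lemma integral_by_parts_compact_support:
  fixes F :: "'a::euclidean_space \<Rightarrow> 'a"
  assumes W: "open W" "compact K" "K \<subseteq> W" and F: "C1_on W F"
    and der: "\<And>x. x \<in> W \<Longrightarrow> GDERIV \<theta> x :> \<theta>' x"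
    and cont: "continuous_on W \<theta>'"
    and supp: "\<And>x. x \<in> W - K \<Longrightarrow> \<theta> x = 0"
  shows "integrable lborel (\<lambda>x. indicator W x * (\<theta> x * divergence F x + F x \<bullet> \<theta>' x))"
    and "(LINT x|lborel. indicator W x * (\<theta> x * divergence F x + F x \<bullet> \<theta>' x)) = 0"
proof -
  define f' where "f' b x h = \<theta> x * (frechet_derivative F (at x) h \<bullet> b) + (h \<bullet> \<theta>' x) * (F x \<bullet> b)" for b x h
  have cont\<theta>: "continuous_on W \<theta>"
    using der unfolding gderiv_def
    by (intro continuous_at_imp_continuous_on ballI has_derivative_continuous) auto
  have der_f: "((\<lambda>x. \<theta> x * (F x \<bullet> b)) has_derivative f' b x) (at x)" if "x \<in> W" for b x
    unfolding f'_def
    by (intro has_derivative_mult has_derivative_inner_left der[unfolded gderiv_def]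
        C1_on_derivative(1)[OF F] that)
  have cont_f: "continuous_on W (\<lambda>x. f' b x b)" for b
    unfolding f'_def by (intro continuous_intros cont cont\<theta> C1_on_derivative(2)[OF F] C1_on_continuous[OF F])
  have supp_f: "\<theta> x * (F x \<bullet> b) = 0" if "x \<in> W - K" for b x
    using supp[OF that] by simp
  note I = integral_directional_derivative_open_eq_0[of W K "\<lambda>x. \<theta> x * (F x \<bullet> b)" "f' b" b for b,
      OF W der_f cont_f supp_f]
  have eq: "indicator W x * (\<theta> x * divergence F x + F x \<bullet> \<theta>' x) = (\<Sum>b\<in>Basis. indicator W x * f' b x b)" for x
    by (simp add: f'_def divergence_def sum.distrib sum_distrib_left euclidean_inner[of "F x"] algebra_simps inner_commute)
  show "integrable lborel (\<lambda>x. indicator W x * (\<theta> x * divergence F x + F x \<bullet> \<theta>' x))"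
    unfolding eq by (intro Bochner_Integration.integrable_sum I)
  show "(LINT x|lborel. indicator W x * (\<theta> x * divergence F x + F x \<bullet> \<theta>' x)) = 0"
    unfolding eq using I by (subst Bochner_Integration.integral_sum) auto
qed

section \<open>Thin strips along a regular level set\<close>

text \<open>
  Along \<open>e\<close> the function \<open>g\<close> grows with slope at least \<open>c\<close>, so a shift by \<open>\<delta> / c\<close> raises it by at
  least the width of the strip: the shifts of \<open>S\<close> by the multiples of \<open>(\<delta> / c) e\<close> are pairwise
  disjoint. At least \<open>c / \<delta>\<close> of them fit into the larger ball.
\<close>
lemma level_strip_measure_le:
  fixes g :: "'a::euclidean_space \<Rightarrow> real" and a :: real
  assumes der: "\<And>x. x \<in> cball x0 r \<Longrightarrow> GDERIV g x :> G x"
    and slope: "\<And>x. x \<in> cball x0 r \<Longrightarrow> c \<le> e \<bullet> G x"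
    and "c > 0" "\<delta> > 0"
  defines "S \<equiv> {x \<in> cball x0 r. a < g x \<and> g x < a + \<delta>}"
  shows "S \<in> sets borel" "S \<in> lmeasurable"
    and "measure lebesgue S \<le> measure lebesgue (cball x0 (r + norm e)) * \<delta> / c"
proof -
  have contg: "continuous_on (cball x0 r) g"
    using der unfolding gderiv_def
    by (intro continuous_at_imp_continuous_on ballI has_derivative_continuous) auto
  have S_eq: "S = cball x0 r \<inter> g -` {a<..<a + \<delta>}"
    by (auto simp: S_def)
  have "openin (top_of_set (cball x0 r)) (cball x0 r \<inter> g -` {a<..<a + \<delta>})"
    by (intro continuous_openin_preimage_gen contg) simp
  then obtain T where "open T" "S = cball x0 r \<inter> T"
    unfolding openin_open S_eq by blast
  then show "S \<in> sets borel" and S: "S \<in> lmeasurable"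
    by (auto intro!: fmeasurable_Int_fmeasurable)
  define \<tau> where "\<tau> = \<delta> / c"
  define N where "N = nat \<lfloor>c / \<delta>\<rfloor>"
  have \<tau>: "\<tau> > 0" using assms by (simp add: \<tau>_def)
  have N: "real N \<le> c / \<delta>" "c / \<delta> \<le> real N + 1"
    using assms by (auto simp: N_def le_floor_iff intro: order.strict_implies_order)
  define T where "T j = (+) ((real j * \<tau>) *\<^sub>R e) ` S" for j
  have rise: "g x - g y \<ge> c * s" if "x \<in> cball x0 r" "y \<in> cball x0 r" "x = y + s *\<^sub>R e" "s > 0" for x y s
  proof -
    have seg: "y + t *\<^sub>R e \<in> cball x0 r" if "0 \<le> t" "t \<le> s" for t
    proof -
      have "y + t *\<^sub>R e = (1 - t / s) *\<^sub>R y + (t / s) *\<^sub>R x"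
        using \<open>s > 0\<close> \<open>x = _\<close> by (simp add: algebra_simps)
      then show ?thesis
        using that \<open>s > 0\<close> convexD[OF convex_cball \<open>y \<in> _\<close> \<open>x \<in> _\<close>, of "1 - t / s" "t / s"] by simp
    qed
    have line: "((\<lambda>t. g (y + t *\<^sub>R e)) has_real_derivative e \<bullet> G (y + t *\<^sub>R e)) (at t)"
      if "0 \<le> t" "t \<le> s" for t
    proof -
      have "((\<lambda>t. y + t *\<^sub>R e) has_derivative (\<lambda>h. h *\<^sub>R e)) (at t)"
        by (auto intro!: derivative_eq_intros)
      from has_derivative_compose[OF this der[OF seg[OF that], unfolded gderiv_def]]
      show ?thesis by (simp add: has_field_derivative_def mult.commute[of _ "e \<bullet> _"])
    qed
    have "\<exists>z>0. z < s \<and> g (y + s *\<^sub>R e) - g (y + 0 *\<^sub>R e) = (s - 0) * (e \<bullet> G (y + z *\<^sub>R e))"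
      by (rule MVT2) (use line \<open>s > 0\<close> in auto)
    then obtain z where z: "0 < z" "z < s" "g x - g y = s * (e \<bullet> G (y + z *\<^sub>R e))"
      using \<open>x = _\<close> by auto
    have "c \<le> e \<bullet> G (y + z *\<^sub>R e)"
      using slope[OF seg] z by simp
    then show ?thesis
      using z \<open>s > 0\<close> by (simp add: mult.commute[of c])
  qed
  have disj: "disjnt (T j) (T k)" if "j < k" for j k
  proof -
    have False if "x \<in> S" "y \<in> S" "(real j * \<tau>) *\<^sub>R e + x = (real k * \<tau>) *\<^sub>R e + y" for x y
    proof -
      define s where "s = (real k - real j) * \<tau>"
      have "1 * \<tau> \<le> s"
        using \<open>j < k\<close> \<tau> unfolding s_def by (intro mult_right_mono) auto
      then have s: "s > 0" "c * s \<ge> \<delta>"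
        using \<tau> \<open>c > 0\<close> by (linarith, simp add: \<tau>_def divide_le_eq mult.commute)
      have "x = y + s *\<^sub>R e"
        using that(3) by (simp add: s_def algebra_simps)
      from rise[OF _ _ this s(1)] that s show False
        by (auto simp: S_def)
    qed
    then show ?thesis by (fastforce simp: disjnt_def T_def)
  qed
  have T_meas: "T j \<in> lmeasurable" "measure lebesgue (T j) = measure lebesgue S" for j
    unfolding T_def using S by (auto simp: measurable_translation measure_translation)
  have T_sub: "T j \<subseteq> cball x0 (r + norm e)" if "j \<le> N" for j
  proof
    fix z assume "z \<in> T j"
    then obtain x where x: "x \<in> S" "z = (real j * \<tau>) *\<^sub>R e + x" by (auto simp: T_def)
    have "real j \<le> c / \<delta>" using that N by linarith
    then have "real j * \<tau> \<le> c / \<delta> * \<tau>"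
      using \<tau> by (intro mult_right_mono) auto
    then have "real j * \<tau> \<le> 1" using assms by (simp add: \<tau>_def)
    then have "norm ((real j * \<tau>) *\<^sub>R e) \<le> norm e"
      using \<tau> by (simp add: mult_left_le_one_le)
    moreover have "dist x0 z \<le> dist x0 x + norm ((real j * \<tau>) *\<^sub>R e)"
      using dist_triangle[of x0 z x] x by (simp add: dist_norm)
    moreover have "dist x0 x \<le> r" using x by (simp add: S_def)
    ultimately show "z \<in> cball x0 (r + norm e)" by simp
  qed
  have "(\<Union>j\<in>{..N}. T j) \<in> lmeasurable"
    by (intro fmeasurable.finite_UN) (auto intro: T_meas)
  then have "measure lebesgue (\<Union>j\<in>{..N}. T j) \<le> measure lebesgue (cball x0 (r + norm e))"
    using T_sub by (intro measure_mono_fmeasurable) (auto intro: fmeasurableD)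
  moreover have "measure lebesgue (\<Union>j\<in>{..N}. T j) = (\<Sum>j\<in>{..N}. measure lebesgue (T j))"
  proof (rule measure_UNION')
    show "pairwise (\<lambda>i j. disjnt (T i) (T j)) {..N}"
      unfolding pairwise_def using disj by (metis disjnt_sym nat_neq_iff)
  qed (auto intro: T_meas)
  ultimately have "(real N + 1) * measure lebesgue S \<le> measure lebesgue (cball x0 (r + norm e))"
    by (simp add: T_meas add.commute)
  moreover have "c / \<delta> * measure lebesgue S \<le> (real N + 1) * measure lebesgue S"
    using N by (intro mult_right_mono) auto
  ultimately have "c / \<delta> * measure lebesgue S \<le> measure lebesgue (cball x0 (r + norm e))"
    by linarith
  then show "measure lebesgue S \<le> measure lebesgue (cball x0 (r + norm e)) * \<delta> / c"
    using assms by (simp add: field_simps)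
qed

lemma GDERIV_ray:
  assumes "GDERIV g x :> D"
  shows "((\<lambda>t. g (x + t *\<^sub>R d)) has_real_derivative d \<bullet> D) (at 0)"
proof -
  have "((\<lambda>t. x + t *\<^sub>R d) has_derivative (\<lambda>h. h *\<^sub>R d)) (at 0)"
    by (auto intro!: derivative_eq_intros)
  from has_derivative_compose[OF this, of g "\<lambda>h. h \<bullet> D"] assms
  show ?thesis by (simp add: gderiv_def has_field_derivative_def mult.commute[of _ "d \<bullet> _"])
qed

lemma level_set_boundary:
  fixes g :: "'a::euclidean_space \<Rightarrow> real"
  assumes "open \<Omega>" "open U" "continuous_on U g" "\<Omega> \<inter> U = {y \<in> U. g y < 0}" "y \<in> closure \<Omega>" "y \<in> U"
  shows "g y \<le> 0" and "y \<notin> \<Omega> \<Longrightarrow> g y = 0" and "g y = 0 \<Longrightarrow> y \<in> frontier \<Omega>"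
proof -
  show le: "g y \<le> 0"
  proof (rule ccontr)
    assume "\<not> g y \<le> 0"
    then have "y \<in> U \<inter> g -` {0<..}" using assms by auto
    moreover have "open (U \<inter> g -` {0<..})"
      using assms by (intro continuous_open_preimage) auto
    ultimately have "\<Omega> \<inter> (U \<inter> g -` {0<..}) \<noteq> {}"
      using \<open>y \<in> closure \<Omega>\<close> by (meson closure_iff_nhds_not_empty subset_refl)
    then obtain z where "z \<in> \<Omega> \<inter> U" "g z > 0" by auto
    then show False unfolding assms(4) by simp
  qed
  show "g y = 0" if "y \<notin> \<Omega>"
    using that assms le by (auto simp: order.order_iff_strict)
  show "y \<in> frontier \<Omega>" if "g y = 0"
  proof -
    have "y \<notin> {y \<in> U. g y < 0}" using that by simp
    then have "y \<notin> \<Omega>" using \<open>y \<in> U\<close> unfolding assms(4)[symmetric] by simp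
    then show ?thesis using assms by (simp add: frontier_def interior_open)
  qed
qed

text \<open>
  If \<open>\<nu>\<close> and \<open>\<nu>'\<close> were different unit normals, the direction \<open>\<nu>' - \<nu>\<close> would point into \<open>\<Omega>\<close>
  according to \<open>\<nu>\<close> and out of it according to \<open>\<nu>'\<close>.
\<close>
lemma outward_unit_normal_unique:
  fixes \<Omega> :: "'a::euclidean_space set"
  assumes "open \<Omega>" "outward_unit_normal \<Omega> x \<nu>" "outward_unit_normal \<Omega> x \<nu>'"
  shows "\<nu> = \<nu>'"
proof (rule ccontr)
  assume "\<nu> \<noteq> \<nu>'"
  obtain U g where U: "open U" "x \<in> U" "C1_on U g" "grad g x \<noteq> 0" "\<Omega> \<inter> U = {y \<in> U. g y < 0}"
    "\<nu> = grad g x /\<^sub>R norm (grad g x)"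
    using assms(2) by (auto simp: outward_unit_normal_def)
  obtain U' g' where U': "open U'" "x \<in> U'" "C1_on U' g'" "grad g' x \<noteq> 0" "\<Omega> \<inter> U' = {y \<in> U'. g' y < 0}"
    "\<nu>' = grad g' x /\<^sub>R norm (grad g' x)"
    using assms(3) by (auto simp: outward_unit_normal_def)
  have xc: "x \<in> closure \<Omega>" "x \<notin> \<Omega>"
    using assms(1,2) by (auto simp: outward_unit_normal_def frontier_def interior_open)
  have "g x = 0" "g' x = 0"
    using level_set_boundary(2)[OF assms(1) U(1) C1_on_continuous[OF U(3)] U(5) xc(1) U(2) xc(2)]
      level_set_boundary(2)[OF assms(1) U'(1) C1_on_continuous[OF U'(3)] U'(5) xc(1) U'(2) xc(2)] by auto
  define d where "d = \<nu>' - \<nu>"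
  have unit: "\<nu> \<bullet> \<nu> = 1" "\<nu>' \<bullet> \<nu>' = 1"
    using U U' by (auto simp: dot_square_norm power2_eq_square divide_simps)
  have "0 < d \<bullet> d" using \<open>\<nu> \<noteq> \<nu>'\<close> by (simp add: d_def)
  then have "d \<bullet> \<nu> < 0" "0 < d \<bullet> \<nu>'"
    using unit by (auto simp: d_def inner_diff inner_commute)
  moreover have "grad g x = norm (grad g x) *\<^sub>R \<nu>" "grad g' x = norm (grad g' x) *\<^sub>R \<nu>'"
    using U U' by auto
  ultimately have "d \<bullet> grad g x < 0" "0 < d \<bullet> grad g' x"
    using U U' by (metis inner_scaleR_right mult_pos_neg zero_less_norm_iff,
      metis inner_scaleR_right mult_pos_pos zero_less_norm_iff)
  then obtain s s' where s: "s > 0" "\<And>h. 0 < h \<Longrightarrow> h < s \<Longrightarrow> g (x + h *\<^sub>R d) < 0"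
    and s': "s' > 0" "\<And>h. 0 < h \<Longrightarrow> h < s' \<Longrightarrow> 0 < g' (x + h *\<^sub>R d)"
    using DERIV_neg_dec_right[OF GDERIV_ray[OF C1_on_GDERIV[OF U(3,2)]], of d]
      DERIV_pos_inc_right[OF GDERIV_ray[OF C1_on_GDERIV[OF U'(3,2)]], of d] \<open>g x = 0\<close> \<open>g' x = 0\<close> by auto
  have "((\<lambda>h. x + h *\<^sub>R d) \<longlongrightarrow> x + 0 *\<^sub>R d) (at_right 0)"
    by (intro tendsto_intros)
  then have "\<forall>\<^sub>F h in at_right 0. x + h *\<^sub>R d \<in> U \<inter> U'"
    using U U' by (intro topological_tendstoD) auto
  moreover have "\<forall>\<^sub>F h in at_right 0. h < min s s' \<and> 0 < h"
    using s s' by (intro eventually_conj eventually_at_right_less) (auto simp: eventually_at_right_field intro: exI[of _ "min s s'"])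
  ultimately have "\<forall>\<^sub>F h in at_right (0::real). False"
  proof eventually_elim
    case (elim h)
    then have "g (x + h *\<^sub>R d) < 0" "0 < g' (x + h *\<^sub>R d)" using s s' by auto
    with elim U U' show False by (smt (verit) IntD1 IntD2 IntI mem_Collect_eq)
  qed
  then show False by simp
qed

section \<open>Test functions\<close>

definition test_function :: "('a::euclidean_space \<Rightarrow> real) \<Rightarrow> ('a \<Rightarrow> 'a) \<Rightarrow> bool" where
  "test_function \<psi> \<psi>' \<longleftrightarrow> (\<forall>x. GDERIV \<psi> x :> \<psi>' x) \<and> continuous_on UNIV \<psi>'"

lemma test_function_continuous: "test_function \<psi> \<psi>' \<Longrightarrow> continuous_on A \<psi>"
  unfolding test_function_def gderiv_def
  by (intro continuous_at_imp_continuous_on ballI has_derivative_continuous) auto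

lemma test_function_continuous': "test_function \<psi> \<psi>' \<Longrightarrow> continuous_on A \<psi>'"
  unfolding test_function_def by (metis continuous_on_subset subset_UNIV)

lemma test_function_mult:
  assumes "test_function \<psi> \<psi>'" "test_function \<zeta> \<zeta>'"
  shows "test_function (\<lambda>x. \<psi> x * \<zeta> x) (\<lambda>x. \<psi> x *\<^sub>R \<zeta>' x + \<zeta> x *\<^sub>R \<psi>' x)"
  unfolding test_function_def
proof safe
  show "GDERIV (\<lambda>x. \<psi> x * \<zeta> x) x :> \<psi> x *\<^sub>R \<zeta>' x + \<zeta> x *\<^sub>R \<psi>' x" for x
    using assms by (intro GDERIV_mult) (auto simp: test_function_def)
qed (intro continuous_intros test_function_continuous[OF assms(1)] test_function_continuous[OF assms(2)]
    test_function_continuous'[OF assms(1)] test_function_continuous'[OF assms(2)])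

lemma test_function_one_minus:
  assumes "test_function \<psi> \<psi>'"
  shows "test_function (\<lambda>x. 1 - \<psi> x) (\<lambda>x. - \<psi>' x)"
  using assms GDERIV_diff[OF GDERIV_const[of 1], of \<psi>]
  by (auto simp: test_function_def intro: continuous_intros)

lemma test_function_cutoff: "test_function (cutoff c r) (cutoff' c r)"
  by (simp add: test_function_def GDERIV_cutoff continuous_on_cutoff')

lemma test_function_gradient_zero:
  assumes "test_function \<psi> \<psi>'" "open S" "x \<in> S" "\<And>y. y \<in> S \<Longrightarrow> \<psi> y = 0"
  shows "\<psi>' x = 0"
proof -
  have "(\<lambda>h. h \<bullet> \<psi>' x) = (\<lambda>h. 0)"
    using assms(1) by (intro has_derivative_locally_zero[OF _ assms(2-4)]) (auto simp: test_function_def gderiv_def)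
  from fun_cong[OF this, of "\<psi>' x"] show ?thesis by simp
qed

text \<open>
  The product of the functions \<open>1 - cutoff c r\<close>; each factor has values in the unit interval, so
  the norms of the gradients just add up.
\<close>
lemma finite_family_cutoff:
  fixes C :: "('a::euclidean_space \<times> real) set"
  assumes "finite C" "\<forall>(c, r)\<in>C. 0 < r"
  shows "\<exists>\<eta> \<eta>'. test_function \<eta> \<eta>' \<and> (\<forall>x. 0 \<le> \<eta> x \<and> \<eta> x \<le> 1) \<and>
    (\<forall>x\<in>(\<Union>(c, r)\<in>C. ball c r). \<eta> x = 0) \<and> (\<forall>x. x \<notin> (\<Union>(c, r)\<in>C. ball c (2 * r)) \<longrightarrow> \<eta> x = 1) \<and>
    (\<forall>x. norm (\<eta>' x) \<le> (\<Sum>(c, r)\<in>C. 6 / r * indicator (ball c (2 * r)) x))"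
  using assms
proof (induction C rule: finite_induct)
  case empty
  have "test_function (\<lambda>x::'a. 1) (\<lambda>x. 0)"
    by (simp add: test_function_def GDERIV_const)
  then show ?case by (intro exI[of _ "\<lambda>x. 1"] exI[of _ "\<lambda>x. 0"]) simp
next
  case (insert p C)
  obtain c r where p: "p = (c, r)" by fastforce
  have r: "r > 0" using insert.prems p by auto
  obtain \<eta> \<eta>' where \<eta>: "test_function \<eta> \<eta>'" "\<And>x. 0 \<le> \<eta> x \<and> \<eta> x \<le> 1"
    "\<And>x. x \<in> (\<Union>(c, r)\<in>C. ball c r) \<Longrightarrow> \<eta> x = 0" "\<And>x. x \<notin> (\<Union>(c, r)\<in>C. ball c (2 * r)) \<Longrightarrow> \<eta> x = 1"
    "\<And>x. norm (\<eta>' x) \<le> (\<Sum>(c, r)\<in>C. 6 / r * indicator (ball c (2 * r)) x)"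
    using insert.IH insert.prems by (smt (verit) insert_iff)
  let ?e = "\<lambda>x. \<eta> x * (1 - cutoff c r x)"
  let ?e' = "\<lambda>x. \<eta> x *\<^sub>R (- cutoff' c r x) + (1 - cutoff c r x) *\<^sub>R \<eta>' x"
  show ?case
  proof (intro exI conjI allI ballI impI)
    show "test_function ?e ?e'"
      by (intro test_function_mult \<eta>(1) test_function_one_minus test_function_cutoff)
    fix x
    show "0 \<le> ?e x" using \<eta>(2)[of x] cutoff_bounds[of c r x] by simp
    show "?e x \<le> 1" using \<eta>(2)[of x] cutoff_bounds[of c r x] by (intro mult_le_one) auto
    show "?e x = 0" if "x \<in> (\<Union>(c, r)\<in>insert p C. ball c r)"
      using that \<eta>(3)[of x] cutoff_near[OF r, of c x] p by auto
    show "?e x = 1" if "x \<notin> (\<Union>(c, r)\<in>insert p C. ball c (2 * r))"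
      using that \<eta>(4)[of x] cutoff_far(1)[OF r, of c x] p by auto
    have "norm (?e' x) \<le> norm (\<eta> x *\<^sub>R (- cutoff' c r x)) + norm ((1 - cutoff c r x) *\<^sub>R \<eta>' x)"
      by (rule norm_triangle_ineq)
    also have "\<dots> \<le> norm (cutoff' c r x) + norm (\<eta>' x)"
      using \<eta>(2)[of x] cutoff_bounds[of c r x] by (intro add_mono) (auto simp: mult_left_le_one_le)
    also have "\<dots> \<le> 6 / r * indicator (ball c (2 * r)) x + (\<Sum>(c, r)\<in>C. 6 / r * indicator (ball c (2 * r)) x)"
      by (intro add_mono norm_cutoff'_le r \<eta>(5))
    also have "\<dots> = (\<Sum>(c, r)\<in>insert p C. 6 / r * indicator (ball c (2 * r)) x)"
      using insert.hyps p by simp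
    finally show "norm (?e' x) \<le> (\<Sum>(c, r)\<in>insert p C. 6 / r * indicator (ball c (2 * r)) x)" .
  qed
qed

section \<open>The weak divergence functional of a tangential field\<close>

locale tangential_field =
  fixes \<Omega> :: "'a::euclidean_space set" and F :: "'a \<Rightarrow> 'a"
  assumes open_domain: "open \<Omega>" and bounded_domain: "bounded \<Omega>"
    and regular: "regular_field \<Omega> F"
    and divergence_integrable: "integrable lborel (\<lambda>x. indicator \<Omega> x * divergence F x)"
    and tangential: "outward_unit_normal \<Omega> x \<nu> \<Longrightarrow> F x \<bullet> \<nu> = 0"
begin

lemma C1_field: "C1_on \<Omega> F" and continuous_field: "continuous_on (closure \<Omega>) F"
  using regular by (auto simp: regular_field_def)

lemma bounded_on_domain:
  fixes h :: "'a \<Rightarrow> 'b::real_normed_vector"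
  assumes "continuous_on (closure \<Omega>) h"
  obtains M where "M > 0" "\<And>x. x \<in> \<Omega> \<Longrightarrow> norm (h x) \<le> M"
proof -
  have "compact (h ` closure \<Omega>)"
    using assms bounded_domain by (intro compact_continuous_image) auto
  then obtain M where "M > 0" "\<forall>y\<in>h ` closure \<Omega>. norm y \<le> M"
    using compact_imp_bounded bounded_pos by blast
  then show ?thesis using that closure_subset by blast
qed

lemma finite_measure_domain: "emeasure lborel \<Omega> < \<infinity>"
  using bounded_domain by (rule emeasure_bounded_finite)

lemma domain_sets: "\<Omega> \<in> sets borel" "\<Omega> \<in> sets lborel"
  using open_domain by auto

text \<open>
  The second argument stands for the gradient of the first, so this is the integral of the
  divergence of \<open>\<psi> F\<close> over \<open>\<Omega>\<close>.
\<close>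
definition weak_divergence :: "('a \<Rightarrow> real) \<Rightarrow> ('a \<Rightarrow> 'a) \<Rightarrow> real" where
  "weak_divergence \<psi> \<psi>' = (LINT x|lborel. indicator \<Omega> x * (\<psi> x * divergence F x + F x \<bullet> \<psi>' x))"

lemma weak_divergence_integrable:
  assumes "test_function \<psi> \<psi>'"
  shows "integrable lborel (\<lambda>x. indicator \<Omega> x * (\<psi> x * divergence F x))"
    and "integrable lborel (\<lambda>x. indicator \<Omega> x * (F x \<bullet> \<psi>' x))"
    and "integrable lborel (\<lambda>x. indicator \<Omega> x * (\<psi> x * divergence F x + F x \<bullet> \<psi>' x))"
proof -
  note cont = test_function_continuous[OF assms] test_function_continuous'[OF assms]
  obtain M where M: "M > 0" "\<And>x. x \<in> \<Omega> \<Longrightarrow> norm (\<psi> x) \<le> M"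
    using bounded_on_domain[OF cont(1)] by blast
  show 1: "integrable lborel (\<lambda>x. indicator \<Omega> x * (\<psi> x * divergence F x))"
  proof (rule Bochner_Integration.integrable_bound)
    show "integrable lborel (\<lambda>x. M * (indicator \<Omega> x * divergence F x))"
      by (intro integrable_mult_right divergence_integrable)
    have "(\<lambda>x. \<psi> x * (indicator \<Omega> x * divergence F x)) \<in> borel_measurable lborel"
      using borel_measurable_continuous_onI[OF cont(1)]
      by (intro borel_measurable_times borel_measurable_integrable[OF divergence_integrable]) simp
    then show "(\<lambda>x. indicator \<Omega> x * (\<psi> x * divergence F x)) \<in> borel_measurable lborel"
      by (simp add: mult.left_commute)
    show "AE x in lborel. norm (indicator \<Omega> x * (\<psi> x * divergence F x)) \<le> norm (M * (indicator \<Omega> x * divergence F x))"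
      using M by (intro always_eventually allI) (auto simp: indicator_def abs_mult intro: mult_right_mono)
  qed
  have contF: "continuous_on (closure \<Omega>) (\<lambda>x. F x \<bullet> \<psi>' x)"
    by (intro continuous_intros continuous_field cont)
  obtain N where N: "N > 0" "\<And>x. x \<in> \<Omega> \<Longrightarrow> norm (F x \<bullet> \<psi>' x) \<le> N"
    using bounded_on_domain[OF contF] by blast
  show 2: "integrable lborel (\<lambda>x. indicator \<Omega> x * (F x \<bullet> \<psi>' x))"
  proof (rule Bochner_Integration.integrable_bound)
    show "integrable lborel (\<lambda>x. N * indicator \<Omega> x :: real)"
      by (intro integrable_mult_right integrable_real_indicator domain_sets finite_measure_domain)
    show "(\<lambda>x. indicator \<Omega> x * (F x \<bullet> \<psi>' x)) \<in> borel_measurable lborel"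
      using borel_measurable_continuous_on_indicator[OF domain_sets(1) continuous_on_subset[OF contF closure_subset]]
      by simp
    show "AE x in lborel. norm (indicator \<Omega> x * (F x \<bullet> \<psi>' x)) \<le> norm (N * indicator \<Omega> x :: real)"
      using N by (intro always_eventually allI) (auto simp: indicator_def)
  qed
  from Bochner_Integration.integrable_add[OF 1 2]
  show "integrable lborel (\<lambda>x. indicator \<Omega> x * (\<psi> x * divergence F x + F x \<bullet> \<psi>' x))"
    by (simp add: distrib_left)
qed

definition locally_null :: "'a \<Rightarrow> real \<Rightarrow> bool" where
  "locally_null x r \<longleftrightarrow> r > 0 \<and>
    (\<forall>\<psi> \<psi>'. test_function \<psi> \<psi>' \<longrightarrow> (\<forall>y. y \<notin> cball x r \<longrightarrow> \<psi> y = 0) \<longrightarrow> weak_divergence \<psi> \<psi>' = 0)"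

lemma locally_null_interior:
  assumes "x \<in> \<Omega>"
  shows "\<exists>r. locally_null x r"
proof -
  obtain r where r: "r > 0" "cball x r \<subseteq> \<Omega>"
    using open_domain assms open_contains_cball by blast
  have "weak_divergence \<psi> \<psi>' = 0" if "test_function \<psi> \<psi>'" "\<And>y. y \<notin> cball x r \<Longrightarrow> \<psi> y = 0" for \<psi> \<psi>'
    unfolding weak_divergence_def
    by (rule integral_by_parts_compact_support(2)[OF open_domain compact_cball r(2) C1_field])
      (use that test_function_continuous'[OF that(1)] in \<open>auto simp: test_function_def\<close>)
  then show ?thesis using r unfolding locally_null_def by blast
qed

text \<open>
  An inductive substitute for a partition of unity: a cutoff of the first ball splits \<open>\<psi>\<close> into a
  part that lives in that ball and a part that vanishes wherever only the first ball covers.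
\<close>
lemma weak_divergence_zero_of_cover:
  assumes "finite P" "\<And>x r. (x, r) \<in> P \<Longrightarrow> locally_null x r" "test_function \<psi> \<psi>'"
    and "\<And>y. y \<in> \<Omega> \<Longrightarrow> \<psi> y \<noteq> 0 \<Longrightarrow> \<exists>(x, r)\<in>P. dist x y \<le> r / 2"
  shows "weak_divergence \<psi> \<psi>' = 0"
  using assms
proof (induction P arbitrary: \<psi> \<psi>' rule: finite_induct)
  case empty
  then have "\<psi> y = 0" if "y \<in> \<Omega>" for y using that by blast
  moreover from this have "\<psi>' y = 0" if "y \<in> \<Omega>" for y
    using test_function_gradient_zero[OF empty.prems(2) open_domain that] by blast
  ultimately have "indicator \<Omega> x * (\<psi> x * divergence F x + F x \<bullet> \<psi>' x) = 0" for x
    by (auto simp: indicator_def)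
  then show ?case unfolding weak_divergence_def by (simp only: Bochner_Integration.integral_zero)
next
  case (insert p P)
  obtain x r where p: "p = (x, r)" by fastforce
  have r: "r > 0" "locally_null x r" using insert.prems(1) p by (auto simp: locally_null_def)
  let ?c = "cutoff x (r / 2)" and ?c' = "cutoff' x (r / 2)"
  let ?a = "\<lambda>y. \<psi> y * ?c y" and ?a' = "\<lambda>y. \<psi> y *\<^sub>R ?c' y + ?c y *\<^sub>R \<psi>' y"
  let ?b = "\<lambda>y. \<psi> y * (1 - ?c y)" and ?b' = "\<lambda>y. \<psi> y *\<^sub>R (- ?c' y) + (1 - ?c y) *\<^sub>R \<psi>' y"
  have a: "test_function ?a ?a'"
    by (intro test_function_mult insert.prems test_function_cutoff)
  have b: "test_function ?b ?b'"
    by (intro test_function_mult insert.prems test_function_one_minus test_function_cutoff)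
  have "?a y = 0" if "y \<notin> cball x r" for y
    using cutoff_far(1)[of "r / 2" x y] r that by auto
  then have "weak_divergence ?a ?a' = 0"
    using r(2) a unfolding locally_null_def by blast
  moreover have "weak_divergence ?b ?b' = 0"
  proof (rule insert.IH[OF _ b])
    fix y assume y: "y \<in> \<Omega>" "?b y \<noteq> 0"
    then obtain q where "q \<in> insert p P" "(\<lambda>(x, r). dist x y \<le> r / 2) q"
      using insert.prems(3)[of y] by auto
    moreover have "\<not> dist x y \<le> r / 2"
      using cutoff_near[of "r / 2" x y] y(2) r by auto
    ultimately show "\<exists>(x, r)\<in>P. dist x y \<le> r / 2" using p by auto
  qed (use insert.prems in auto)
  moreover have "weak_divergence \<psi> \<psi>' = weak_divergence ?a ?a' + weak_divergence ?b ?b'"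
  proof -
    have "indicator \<Omega> y * (\<psi> y * divergence F y + F y \<bullet> \<psi>' y) =
      indicator \<Omega> y * (?a y * divergence F y + F y \<bullet> ?a' y) +
      indicator \<Omega> y * (?b y * divergence F y + F y \<bullet> ?b' y)" for y
      by (simp add: algebra_simps inner_add_right inner_diff_right)
    then show ?thesis
      unfolding weak_divergence_def
      by (simp only:) (rule Bochner_Integration.integral_add[OF weak_divergence_integrable(3)[OF a]
          weak_divergence_integrable(3)[OF b]])
  qed
  ultimately show ?case by simp
qed

text \<open>
  The test function is multiplied by \<open>smooth_step (- g / \<delta> - 1)\<close>, which is 0 for \<open>g \<ge> - \<delta>\<close> and 1 for
  \<open>g \<le> - 2 \<delta>\<close>. The product has compact support in \<open>\<Omega>\<close>, hence integration by parts applies to it.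
  Below, \<open>P \<delta>\<close> is the part of the resulting integrand that tends to the integrand of the weak
  divergence, and \<open>A \<delta>\<close> is the part that comes from the derivative of the step. The latter is of size
  \<open>\<bar>F \<bullet> grad g\<bar> / \<delta>\<close> on a strip of measure \<open>O(\<delta>)\<close>, so its integral tends to zero with the flux.
\<close>
lemma locally_null_boundary:
  assumes "outward_unit_normal \<Omega> x0 \<nu>"
  shows "\<exists>r. locally_null x0 r"
proof -
  obtain U g where U: "open U" "x0 \<in> U" "C1_on U g" "grad g x0 \<noteq> 0" "\<Omega> \<inter> U = {y \<in> U. g y < 0}"
    using assms by (auto simp: outward_unit_normal_def)
  note contg = C1_on_continuous[OF U(3)] and contG = continuous_on_grad[OF U(3)]
  \<comment> \<open>Half the slope at \<open>x0\<close> along the normal direction is kept in a whole ball.\<close>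
  define e where "e = grad g x0"
  define c where "c = (e \<bullet> e) / 2"
  have c: "c > 0" "e \<bullet> e > c" using U by (auto simp: c_def e_def)
  obtain r where r: "r > 0" "cball x0 r \<subseteq> U" and slope: "\<And>x. x \<in> cball x0 r \<Longrightarrow> c \<le> e \<bullet> grad g x"
  proof -
    have "open (U \<inter> (\<lambda>x. e \<bullet> grad g x) -` {c<..})"
      by (intro continuous_open_preimage continuous_intros contG U)
    moreover have "x0 \<in> U \<inter> (\<lambda>x. e \<bullet> grad g x) -` {c<..}"
      using U c by (simp add: e_def)
    ultimately obtain r where "r > 0" "cball x0 r \<subseteq> U \<inter> (\<lambda>x. e \<bullet> grad g x) -` {c<..}"
      using open_contains_cball by blast
    then show ?thesis by (intro that[of r]) (auto intro: less_imp_le)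
  qed
  define B where "B = cball x0 r"
  have B: "compact B" "B \<subseteq> U" using r by (auto simp: B_def)
  have flux_zero: "F y \<bullet> grad g y = 0" if "y \<in> closure \<Omega>" "y \<in> B" "g y = 0" for y
  proof -
    have "y \<in> U" using that B by auto
    then have "y \<in> frontier \<Omega>"
      using level_set_boundary(3)[OF open_domain U(1) contg U(5) that(1)] that by simp
    moreover have "grad g y \<noteq> 0" using slope[of y] that c by (auto simp: B_def)
    ultimately have "outward_unit_normal \<Omega> y (grad g y /\<^sub>R norm (grad g y))"
      unfolding outward_unit_normal_def using U \<open>y \<in> U\<close> by blast
    from tangential[OF this] \<open>grad g y \<noteq> 0\<close> show ?thesis by simp
  qed
  \<comment> \<open>The part of the closure of \<open>\<Omega>\<close> in the ball where the flux is at least \<open>\<epsilon>\<close> is compact and does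
    not meet \<open>g = 0\<close>, so \<open>g\<close> has a negative maximum on it.\<close>
  have flux_small: "\<exists>m>0. \<forall>y\<in>\<Omega> \<inter> B. - m < g y \<longrightarrow> \<bar>F y \<bullet> grad g y\<bar> \<le> \<epsilon>" if "\<epsilon> > 0" for \<epsilon> :: real
  proof -
    define L where "L = (closure \<Omega> \<inter> B) \<inter> (\<lambda>y. \<bar>F y \<bullet> grad g y\<bar>) -` {\<epsilon>..}"
    have cB: "compact (closure \<Omega> \<inter> B)"
      using B by (intro closed_Int_compact) auto
    have "continuous_on (closure \<Omega> \<inter> B) (\<lambda>y. \<bar>F y \<bullet> grad g y\<bar>)"
      using B by (intro continuous_intros continuous_on_subset[OF continuous_field] continuous_on_subset[OF contG]) auto
    then have "closed L"
      unfolding L_def by (intro continuous_closed_preimage compact_imp_closed[OF cB]) auto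
    then have "compact L"
      using cB by (metis L_def compact_Int_closed inf.absorb_iff2 inf_le1)
    show ?thesis
    proof (cases "L = {}")
      case True
      have "\<bar>F y \<bullet> grad g y\<bar> \<le> \<epsilon>" if "y \<in> \<Omega> \<inter> B" for y
      proof (rule ccontr)
        assume "\<not> \<bar>F y \<bullet> grad g y\<bar> \<le> \<epsilon>"
        then have "y \<in> L" using that closure_subset[of \<Omega>] by (auto simp: L_def)
        with True show False by simp
      qed
      then show ?thesis by (intro exI[of _ 1]) auto
    next
      case False
      have "continuous_on L g"
        using B by (intro continuous_on_subset[OF contg]) (auto simp: L_def)
      then obtain z where z: "z \<in> L" "\<And>y. y \<in> L \<Longrightarrow> g y \<le> g z"
        using continuous_attains_sup[OF \<open>compact L\<close> False] by blast
      have zB: "z \<in> closure \<Omega>" "z \<in> B" "\<bar>F z \<bullet> grad g z\<bar> \<ge> \<epsilon>"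
        using z by (auto simp: L_def)
      then have "g z \<noteq> 0" using flux_zero[of z] \<open>\<epsilon> > 0\<close> by auto
      moreover have "g z \<le> 0"
        using level_set_boundary(1)[OF open_domain U(1) contg U(5)] zB B by blast
      ultimately have "g z < 0" by simp
      moreover have "\<bar>F y \<bullet> grad g y\<bar> \<le> \<epsilon>" if "y \<in> \<Omega> \<inter> B" "g z < g y" for y
      proof (rule ccontr)
        assume "\<not> \<bar>F y \<bullet> grad g y\<bar> \<le> \<epsilon>"
        then have "y \<in> L" using that closure_subset[of \<Omega>] by (auto simp: L_def)
        from z(2)[OF this] that show False by simp
      qed
      ultimately show ?thesis by (intro exI[of _ "- g z"]) auto
    qed
  qed
  have "weak_divergence \<psi> \<psi>' = 0" if test: "test_function \<psi> \<psi>'" and supp: "\<And>y. y \<notin> cball x0 r \<Longrightarrow> \<psi> y = 0" for \<psi> \<psi>'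
  proof -
    define V where "V = measure lebesgue (cball x0 (r + norm e))"
    define W where "W = \<Omega> \<inter> U"
    have "open W" unfolding W_def by (intro open_Int open_domain U(1))
    then have W: "open W" "W \<in> sets borel" by auto
    note cont = test_function_continuous[OF test] test_function_continuous'[OF test]
    have supp': "\<psi>' y = 0" if "y \<notin> cball x0 r" for y
      using test_function_gradient_zero[OF test, of "- cball x0 r" y] supp that by (simp add: open_Compl)
    obtain M where M: "M > 0" "\<And>x. x \<in> \<Omega> \<Longrightarrow> norm (\<psi> x) \<le> M"
      using bounded_on_domain[OF cont(1)] by blast
    define h where "h x = \<psi> x * divergence F x + F x \<bullet> \<psi>' x" for x
    define \<sigma> where "\<sigma> \<delta> x = - g x / \<delta> - 1" for \<delta> x
    define P where "P \<delta> x = indicator \<Omega> x * (smooth_step (\<sigma> \<delta> x) * h x)" for \<delta> x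
    define A where "A \<delta> x = indicator W x * (\<psi> x * (smooth_step' (\<sigma> \<delta> x) / \<delta>) * (F x \<bullet> grad g x))" for \<delta> x
    have h0: "h y = 0" if "y \<notin> U" for y
    proof -
      have "y \<notin> cball x0 r" using that r by auto
      then show ?thesis by (simp add: h_def supp supp')
    qed
    have cont_h: "continuous_on W h"
      unfolding h_def W_def
      by (intro continuous_intros cont continuous_on_subset[OF continuous_on_divergence[OF C1_field]]
          continuous_on_subset[OF C1_on_continuous[OF C1_field]]) auto
    have cont_\<sigma>: "continuous_on W (\<sigma> \<delta>)" for \<delta>
      unfolding \<sigma>_def divide_inverse W_def by (intro continuous_intros continuous_on_subset[OF contg]) auto
    have cont_step: "continuous_on W (\<lambda>x. smooth_step (\<sigma> \<delta> x))" "continuous_on W (\<lambda>x. smooth_step' (\<sigma> \<delta> x))" for \<delta>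
      using continuous_on_compose2[OF continuous_on_smooth_step cont_\<sigma>]
        continuous_on_compose2[OF continuous_on_smooth_step' cont_\<sigma>] by auto
    have h_int: "integrable lborel (\<lambda>x. indicator \<Omega> x * h x)"
      unfolding h_def by (rule weak_divergence_integrable(3)[OF test])
    have P_meas: "P \<delta> \<in> borel_measurable lborel" for \<delta>
    proof -
      have "(\<lambda>x. indicator W x *\<^sub>R (smooth_step (\<sigma> \<delta> x) * h x)) \<in> borel_measurable borel"
        by (intro borel_measurable_continuous_on_indicator W continuous_intros cont_h cont_step)
      moreover have "(\<lambda>x. indicator W x *\<^sub>R (smooth_step (\<sigma> \<delta> x) * h x)) = P \<delta>"
        by (auto simp: P_def W_def indicator_def h0 fun_eq_iff)
      ultimately show ?thesis by simp
    qed
    have P_le: "norm (P \<delta> x) \<le> norm (indicator \<Omega> x * h x)" for \<delta> x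
      using smooth_step_bounds[of "\<sigma> \<delta> x"] by (auto simp: P_def indicator_def abs_mult mult_left_le_one_le)
    have P_int: "integrable lborel (P \<delta>)" for \<delta>
      by (rule Bochner_Integration.integrable_bound[OF h_int P_meas]) (intro always_eventually allI P_le)
    have parts: "integrable lborel (\<lambda>x. P \<delta> x - A \<delta> x)" "(LINT x|lborel. P \<delta> x - A \<delta> x) = 0" if "\<delta> > 0" for \<delta>
    proof -
      define \<theta> where "\<theta> x = \<psi> x * smooth_step (\<sigma> \<delta> x)" for x
      define \<theta>' where "\<theta>' x = \<psi> x *\<^sub>R (smooth_step' (\<sigma> \<delta> x) *\<^sub>R ((- 1 / \<delta>) *\<^sub>R grad g x)) + smooth_step (\<sigma> \<delta> x) *\<^sub>R \<psi>' x" for x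
      define K where "K = B \<inter> g -` {..- \<delta>}"
      have der: "GDERIV \<theta> x :> \<theta>' x" if "x \<in> W" for x
      proof -
        have "GDERIV g x :> grad g x" using that by (intro C1_on_GDERIV[OF U(3)]) (auto simp: W_def)
        moreover have "((\<lambda>t. - t / \<delta> - 1) has_real_derivative - 1 / \<delta>) (at t)" for t
          using DERIV_diff[OF DERIV_cdivide[OF DERIV_minus[OF DERIV_ident], of \<delta>] DERIV_const[of 1]] by simp
        ultimately have "GDERIV (\<sigma> \<delta>) x :> (- 1 / \<delta>) *\<^sub>R grad g x"
          unfolding \<sigma>_def by (rule GDERIV_DERIV_compose)
        then show ?thesis
          unfolding \<theta>_def \<theta>'_def using test
          by (intro GDERIV_mult GDERIV_DERIV_compose[OF _ DERIV_smooth_step]) (auto simp: test_function_def)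
      qed
      have cont_\<theta>': "continuous_on W \<theta>'"
        unfolding \<theta>'_def by (intro continuous_intros cont cont_step continuous_on_subset[OF contG]) (auto simp: W_def)
      have "closed K"
        unfolding K_def
        by (intro continuous_closed_preimage continuous_on_subset[OF contg B(2)]
            compact_imp_closed[OF B(1)] closed_atMost)
      then have "compact K"
        using B by (metis K_def compact_Int_closed inf.absorb_iff2 inf_le1)
      have "K \<subseteq> {y \<in> U. g y < 0}"
        using B that by (auto simp: K_def)
      then have "K \<subseteq> W" unfolding W_def U(5) .
      have supp_\<theta>: "\<theta> x = 0" if "x \<in> W - K" for x
      proof (cases "x \<in> B")
        case True
        then have "g x > - \<delta>" using that by (auto simp: K_def)
        then have "\<sigma> \<delta> x \<le> 0" using \<open>\<delta> > 0\<close> by (simp add: \<sigma>_def field_simps)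
        then show ?thesis by (simp add: \<theta>_def smooth_step_nonpos)
      qed (simp add: \<theta>_def supp B_def)
      have eq: "indicator W x * (\<theta> x * divergence F x + F x \<bullet> \<theta>' x) = P \<delta> x - A \<delta> x" for x
      proof (cases "x \<in> W")
        case True
        then show ?thesis
          by (simp add: W_def P_def A_def h_def \<theta>_def \<theta>'_def inner_add_right algebra_simps)
      next
        case False
        then show ?thesis by (auto simp: W_def P_def A_def h0)
      qed
      note I = integral_by_parts_compact_support[OF W(1) \<open>compact K\<close> \<open>K \<subseteq> W\<close>
          C1_on_subset[OF C1_field] der cont_\<theta>' supp_\<theta>, unfolded eq]
      show "integrable lborel (\<lambda>x. P \<delta> x - A \<delta> x)" "(LINT x|lborel. P \<delta> x - A \<delta> x) = 0"
        using I by (auto simp: W_def)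
    qed
    have small: "\<exists>d>0. \<forall>\<delta>. 0 < \<delta> \<and> \<delta> < d \<longrightarrow> \<bar>LINT x|lborel. P \<delta> x\<bar> \<le> 4 * M * V / c * \<epsilon>" if "\<epsilon> > 0" for \<epsilon> :: real
    proof -
      obtain m where m: "m > 0" "\<And>y. y \<in> \<Omega> \<inter> B \<Longrightarrow> - m < g y \<Longrightarrow> \<bar>F y \<bullet> grad g y\<bar> \<le> \<epsilon>"
        using flux_small[OF \<open>\<epsilon> > 0\<close>] by blast
      have "\<bar>LINT x|lborel. P \<delta> x\<bar> \<le> 4 * M * V / c * \<epsilon>" if \<delta>: "0 < \<delta>" "\<delta> < m / 2" for \<delta>
      proof -
        define S where "S = {x \<in> cball x0 r. - 2 * \<delta> < g x \<and> g x < - 2 * \<delta> + \<delta>}"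
        have gder: "GDERIV g x :> grad g x" if "x \<in> cball x0 r" for x
          using that r by (intro C1_on_GDERIV[OF U(3)]) auto
        note S = level_strip_measure_le[of x0 r g "grad g" c e \<delta> "- 2 * \<delta>", OF gder slope c(1) \<delta>(1),
            folded S_def V_def]
        have A_int: "integrable lborel (A \<delta>)"
          using Bochner_Integration.integrable_diff[OF P_int[of \<delta>] parts(1)[OF \<delta>(1)]] by simp
        have PA: "(LINT x|lborel. P \<delta> x) = (LINT x|lborel. A \<delta> x)"
          using parts(2)[OF \<delta>(1)] Bochner_Integration.integral_diff[OF P_int[of \<delta>] A_int] by simp
        \<comment> \<open>The derivative of the step is nonzero only where its argument lies in the unit interval,
          that is, on the strip.\<close>
        have A_le: "norm (A \<delta> x) \<le> (4 * M * \<epsilon> / \<delta>) * indicator S x" for x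
        proof (cases "x \<in> W \<and> x \<in> cball x0 r \<and> 0 < \<sigma> \<delta> x \<and> \<sigma> \<delta> x < 1")
          case True
          then have x: "x \<in> \<Omega> \<inter> B" by (auto simp: W_def B_def)
          have g: "- 2 * \<delta> < g x" "g x < - \<delta>"
            using True \<delta> by (auto simp: \<sigma>_def field_simps)
          have "\<bar>F x \<bullet> grad g x\<bar> \<le> \<epsilon>" using m(2)[OF x] g \<delta> by simp
          moreover have "\<bar>\<psi> x\<bar> \<le> M" using M x by auto
          ultimately have "\<bar>\<psi> x\<bar> * (smooth_step' (\<sigma> \<delta> x) / \<delta>) * \<bar>F x \<bullet> grad g x\<bar> \<le> M * (4 / \<delta>) * \<epsilon>"
            using smooth_step'_bounds[of "\<sigma> \<delta> x"] \<delta> M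
            by (intro mult_mono divide_right_mono) auto
          moreover have "norm (A \<delta> x) = \<bar>\<psi> x\<bar> * (smooth_step' (\<sigma> \<delta> x) / \<delta>) * \<bar>F x \<bullet> grad g x\<bar>"
            using True \<delta> smooth_step'_bounds[of "\<sigma> \<delta> x"] by (simp add: A_def abs_mult)
          moreover have "x \<in> S" using True g by (simp add: S_def)
          ultimately show ?thesis by (simp add: mult.commute mult.left_commute)
        next
          case False
          then have "A \<delta> x = 0"
            by (auto simp: A_def supp smooth_step_nonpos smooth_step_ge_1 not_less)
          then show ?thesis using M \<delta> \<open>\<epsilon> > 0\<close> by (simp add: indicator_def)
        qed
        have Sfin: "emeasure lborel S < \<infinity>"
          by (intro emeasure_bounded_finite bounded_subset[OF bounded_cball[of x0 r]]) (auto simp: S_def)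
        have S_int: "integrable lborel (\<lambda>x. (4 * M * \<epsilon> / \<delta>) * indicator S x :: real)"
          using S(1) Sfin by (intro integrable_mult_right integrable_real_indicator) auto
        have "norm (LINT x|lborel. A \<delta> x) \<le> (LINT x|lborel. (4 * M * \<epsilon> / \<delta>) * indicator S x)"
          by (intro Bochner_Integration.integral_norm_bound_integral A_int S_int A_le)
        also have "\<dots> = (4 * M * \<epsilon> / \<delta>) * measure lborel S"
          by simp
        also have "measure lborel S = measure lebesgue S"
          using S(1) by (simp add: measure_completion)
        also have "(4 * M * \<epsilon> / \<delta>) * measure lebesgue S \<le> (4 * M * \<epsilon> / \<delta>) * (V * \<delta> / c)"
          using S(3) M \<delta> \<open>\<epsilon> > 0\<close> by (intro mult_left_mono) auto
        also have "\<dots> = 4 * M * V / c * \<epsilon>"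
          using \<delta> by (simp add: field_simps)
        finally show ?thesis using PA by simp
      qed
      then show ?thesis using m(1) by (intro exI[of _ "m / 2"]) auto
    qed
    have lim: "(\<lambda>n. LINT x|lborel. P (1 / Suc n) x) \<longlonglongrightarrow> weak_divergence \<psi> \<psi>'"
      unfolding weak_divergence_def
    proof (rule integral_dominated_convergence[where w = "\<lambda>x. norm (indicator \<Omega> x * h x)"])
      show "(\<lambda>x. indicator \<Omega> x * (\<psi> x * divergence F x + F x \<bullet> \<psi>' x)) \<in> borel_measurable lborel"
        using h_int unfolding h_def by (rule borel_measurable_integrable)
      show "integrable lborel (\<lambda>x. norm (indicator \<Omega> x * h x))"
        using h_int by (rule integrable_norm)
      show "AE x in lborel. norm (P (1 / Suc n) x) \<le> norm (indicator \<Omega> x * h x)" for n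
        by (intro always_eventually allI P_le)
      show "AE x in lborel. (\<lambda>n. P (1 / Suc n) x) \<longlonglongrightarrow> indicator \<Omega> x * (\<psi> x * divergence F x + F x \<bullet> \<psi>' x)"
      proof (intro always_eventually allI)
        fix x
        show "(\<lambda>n. P (1 / Suc n) x) \<longlonglongrightarrow> indicator \<Omega> x * (\<psi> x * divergence F x + F x \<bullet> \<psi>' x)"
        proof (cases "x \<in> \<Omega> \<inter> U")
          case True
          then have "g x < 0" unfolding U(5) by simp
          obtain N :: nat where N: "2 / (- g x) < real N" using reals_Archimedean2 by blast
          have "P (1 / Suc n) x = indicator \<Omega> x * h x" if "N \<le> n" for n
          proof -
            have "2 / (- g x) \<le> real (Suc n)" using N that by linarith
            then have "\<sigma> (1 / Suc n) x \<ge> 1"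
              using \<open>g x < 0\<close> by (simp add: \<sigma>_def field_simps)
            then show ?thesis by (simp add: P_def smooth_step_ge_1)
          qed
          then have "\<forall>\<^sub>F n in sequentially. P (1 / Suc n) x = indicator \<Omega> x * h x"
            unfolding eventually_sequentially by blast
          then show ?thesis unfolding h_def by (rule tendsto_eventually)
        next
          case False
          then have "indicator \<Omega> x * h x = 0" by (auto simp: h0)
          moreover from this have "P (1 / Suc n) x = 0" for n by (auto simp: P_def)
          ultimately show ?thesis unfolding h_def by (simp only: tendsto_const)
        qed
      qed
    qed (rule P_meas)
    have le: "\<bar>weak_divergence \<psi> \<psi>'\<bar> \<le> 4 * M * V / c * \<epsilon>" if "\<epsilon> > 0" for \<epsilon> :: real
    proof -
      obtain d where d: "d > 0" "\<And>\<delta>. 0 < \<delta> \<Longrightarrow> \<delta> < d \<Longrightarrow> \<bar>LINT x|lborel. P \<delta> x\<bar> \<le> 4 * M * V / c * \<epsilon>"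
        using small[OF \<open>\<epsilon> > 0\<close>] by blast
      have "(\<lambda>n. 1 / real (Suc n)) \<longlonglongrightarrow> 0"
        using LIMSEQ_Suc[OF lim_1_over_n] by simp
      from order_tendstoD(2)[OF this d(1)]
      have "\<forall>\<^sub>F n in sequentially. \<bar>LINT x|lborel. P (1 / Suc n) x\<bar> \<le> 4 * M * V / c * \<epsilon>"
      proof eventually_elim
        case (elim n)
        then show ?case by (intro d(2)) simp_all
      qed
      from tendsto_upperbound[OF tendsto_rabs[OF lim] this trivial_limit_sequentially] show ?thesis .
    qed
    have "V \<ge> 0" by (simp add: V_def)
    show ?thesis
    proof (rule ccontr)
      assume "weak_divergence \<psi> \<psi>' \<noteq> 0"
      define k where "k = 4 * M * V / c"
      have "k \<ge> 0" using M c \<open>V \<ge> 0\<close> by (simp add: k_def)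
      have "\<bar>weak_divergence \<psi> \<psi>'\<bar> > 0" using \<open>weak_divergence \<psi> \<psi>' \<noteq> 0\<close> by simp
      moreover from this have "\<bar>weak_divergence \<psi> \<psi>'\<bar> \<le> k * (\<bar>weak_divergence \<psi> \<psi>'\<bar> / (k + 1))"
        using le[of "\<bar>weak_divergence \<psi> \<psi>'\<bar> / (k + 1)"] \<open>k \<ge> 0\<close> by (simp add: k_def)
      ultimately show False using \<open>k \<ge> 0\<close> by (simp add: field_simps)
    qed
  qed
  then show ?thesis using r unfolding locally_null_def by blast
qed

lemma weak_divergence_zero_away_from_edges:
  assumes test: "test_function \<psi> \<psi>'" and "open T" "frontier \<Omega> - smooth_boundary \<Omega> \<subseteq> T"
    and zero: "\<And>y. y \<in> T \<Longrightarrow> \<psi> y = 0"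
  shows "weak_divergence \<psi> \<psi>' = 0"
proof -
  define K where "K = closure \<Omega> - T"
  have "compact K"
    using bounded_domain \<open>open T\<close> by (auto simp: K_def intro: compact_diff)
  have "\<exists>r. locally_null x r" if "x \<in> K" for x
  proof (cases "x \<in> \<Omega>")
    case False
    then have "x \<in> smooth_boundary \<Omega>"
      using that assms(3) open_domain by (auto simp: K_def frontier_def interior_open)
    then show ?thesis using locally_null_boundary by (auto simp: smooth_boundary_def)
  qed (rule locally_null_interior)
  then obtain \<rho> where \<rho>: "\<And>x. x \<in> K \<Longrightarrow> locally_null x (\<rho> x)" by metis
  then have pos: "\<rho> x > 0" if "x \<in> K" for x using that by (auto simp: locally_null_def)
  obtain D where D: "D \<subseteq> K" "finite D" "K \<subseteq> (\<Union>x\<in>D. ball x (\<rho> x / 2))"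
  proof (rule compactE_image[OF \<open>compact K\<close>, of K "\<lambda>x. ball x (\<rho> x / 2)"])
    show "K \<subseteq> (\<Union>x\<in>K. ball x (\<rho> x / 2))" using pos by force
  qed auto
  show ?thesis
  proof (rule weak_divergence_zero_of_cover[OF _ _ test, of "(\<lambda>x. (x, \<rho> x)) ` D"])
    fix y assume "y \<in> \<Omega>" "\<psi> y \<noteq> 0"
    then have "y \<in> K" using zero closure_subset by (auto simp: K_def)
    then obtain x where "x \<in> D" "dist x y < \<rho> x / 2" using D by auto
    then show "\<exists>(x, r)\<in>(\<lambda>x. (x, \<rho> x)) ` D. dist x y \<le> r / 2" by force
  qed (use D \<rho> in auto)
qed

section \<open>The divergence theorem for tangential fields\<close>

text \<open>
  The edges contribute an arbitrarily small error: removing balls of radii \<open>r\<close> costs at most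
  \<open>sup \<bar>F\<bar>\<close> times the sum of \<open>(6 / r)\<close> times the volumes of the balls of radii \<open>2 * r\<close>, a constant
  multiple of the sum that is less than \<open>e\<close>. In dimension 1 every summand is 1, and \<open>e \<le> 1\<close> leaves no
  balls at all.
\<close>
lemma cutoff_around_edges:
  assumes "piecewise_smooth_boundary \<Omega>"
  shows "\<exists>k. \<forall>e. 0 < e \<longrightarrow> e \<le> 1 \<longrightarrow> (\<exists>\<eta> A. \<eta> \<in> borel_measurable lborel \<and> (\<forall>x. \<bar>\<eta> x\<bar> \<le> 1) \<and>
    A \<in> sets lborel \<and> emeasure lborel A < \<infinity> \<and> measure lborel A \<le> k * e \<and> (\<forall>x. x \<notin> A \<longrightarrow> \<eta> x = 1) \<and>
    \<bar>LINT x|lborel. indicator \<Omega> x * (\<eta> x * divergence F x)\<bar> \<le> k * e)"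
proof -
  obtain M where M: "M > 0" "\<And>x. x \<in> \<Omega> \<Longrightarrow> norm (F x) \<le> M"
    using bounded_on_domain[OF continuous_field] by blast
  define \<kappa> where "\<kappa> = 2 ^ DIM('a) * measure lborel (ball (0::'a) 1)"
  have "\<kappa> \<ge> 0" by (simp add: \<kappa>_def)
  have ball: "measure lborel (ball c (2 * r)) = \<kappa> * (r * r ^ (DIM('a) - 1))" if "r > 0" for c :: 'a and r
    using content_ball_conv_unit_ball[of "2 * r" c] that
    by (simp add: \<kappa>_def power_mult_distrib mult_ac flip: power_Suc)
  show ?thesis
  proof (intro exI[of _ "(6 * M + 1) * \<kappa>"] allI impI)
    fix e :: real assume e: "0 < e" "e \<le> 1"
    note cover = assms[unfolded piecewise_smooth_boundary_def surface_null_def, THEN spec, THEN mp, OF e(1)]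
    obtain C :: "('a \<times> real) set" where C1: "finite C" and pos: "\<forall>(c, r)\<in>C. 0 < r"
      and C34: "frontier \<Omega> - smooth_boundary \<Omega> \<subseteq> (\<Union>(c, r)\<in>C. ball c r)" "(\<Sum>(c, r)\<in>C. r ^ (DIM('a) - 1)) < e"
      by (rule exE[OF cover]) (elim conjE)
    have C2: "\<And>c r. (c, r) \<in> C \<Longrightarrow> 0 < r" using pos by auto
    note C = C1 C2 C34
    define s where "s = (\<Sum>(c, r)\<in>C. r ^ (DIM('a) - 1))"
    \<comment> \<open>Since the radii are at most 1, the sum that the cover controls bounds the total volume up to a constant.\<close>
    have r_le: "r \<le> 1" if "(c, r) \<in> C" for c r
    proof (rule ccontr)
      assume "\<not> r \<le> 1"
      then have "1 \<le> r ^ (DIM('a) - 1)" by (intro one_le_power) auto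
      also have "\<dots> = (\<lambda>(c, r). r ^ (DIM('a) - 1)) (c, r)" by simp
      also have "\<dots> \<le> s"
        unfolding s_def by (rule member_le_sum[OF that _ C(1)]) (use C(2) in \<open>auto intro!: zero_le_power less_imp_le\<close>)
      finally show False using C(4) e(2) by (simp add: s_def)
    qed
    obtain \<eta> \<eta>' where test: "test_function \<eta> \<eta>'" and range: "\<forall>x. 0 \<le> \<eta> x \<and> \<eta> x \<le> 1"
      and near: "\<forall>x\<in>(\<Union>(c, r)\<in>C. ball c r). \<eta> x = 0"
      and far: "\<forall>x. x \<notin> (\<Union>(c, r)\<in>C. ball c (2 * r)) \<longrightarrow> \<eta> x = 1"
      and slope: "\<forall>x. norm (\<eta>' x) \<le> (\<Sum>(c, r)\<in>C. 6 / r * indicator (ball c (2 * r)) x)"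
      by (rule exE[OF finite_family_cutoff[OF C1 pos]], elim exE conjE)
    note \<eta> = test range[THEN spec] near[THEN bspec] far[THEN spec, THEN mp] slope[THEN spec]
    define A where "A = (\<Union>p\<in>C. ball (fst p) (2 * snd p))"
    have A_eq: "A = (\<Union>(c, r)\<in>C. ball c (2 * r))" by (simp add: A_def case_prod_beta)
    have "bounded A" unfolding A_def using C(1) by (intro bounded_UN) auto
    have A_meas: "measure lborel A \<le> (6 * M + 1) * \<kappa> * e"
    proof -
      have "measure lborel A \<le> (\<Sum>p\<in>C. measure lborel (ball (fst p) (2 * snd p)))"
        unfolding A_def using C(1) by (intro measure_UNION_le) auto
      also have "\<dots> = (\<Sum>(c, r)\<in>C. \<kappa> * (r * r ^ (DIM('a) - 1)))"
        using C(2) by (intro sum.cong refl) (auto simp: ball)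
      also have "\<dots> \<le> (\<Sum>(c, r)\<in>C. \<kappa> * (1 * r ^ (DIM('a) - 1)))"
      proof (intro sum_mono, clarify)
        fix c r assume "(c, r) \<in> C"
        with C(2) r_le have "0 \<le> r" "r \<le> 1" by (auto intro: less_imp_le)
        then show "\<kappa> * (r * r ^ (DIM('a) - 1)) \<le> \<kappa> * (1 * r ^ (DIM('a) - 1))"
          by (intro mult_left_mono mult_right_mono zero_le_power \<open>\<kappa> \<ge> 0\<close>)
      qed
      also have "\<dots> = \<kappa> * s"
        by (simp add: s_def sum_distrib_left case_prod_beta)
      also have "\<dots> \<le> \<kappa> * e" using C(4) \<open>\<kappa> \<ge> 0\<close> by (intro mult_left_mono) (auto simp: s_def)
      also have "\<dots> \<le> (6 * M + 1) * \<kappa> * e"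
        using M(1) \<open>\<kappa> \<ge> 0\<close> e by (intro mult_right_mono) (auto simp: mult_le_cancel_right1)
      finally show ?thesis .
    qed
    have weak: "weak_divergence \<eta> \<eta>' = 0"
    proof (rule weak_divergence_zero_away_from_edges[OF \<eta>(1) _ C(3) \<eta>(3)])
      show "open (\<Union>(c, r)\<in>C. ball c r)" by (auto intro!: open_UN)
    qed
    have "weak_divergence \<eta> \<eta>' = (LINT x|lborel. indicator \<Omega> x * (\<eta> x * divergence F x))
        + (LINT x|lborel. indicator \<Omega> x * (F x \<bullet> \<eta>' x))"
      unfolding weak_divergence_def distrib_left
      by (rule Bochner_Integration.integral_add[OF weak_divergence_integrable(1,2)[OF \<eta>(1)]])
    then have flux: "\<bar>LINT x|lborel. indicator \<Omega> x * (\<eta> x * divergence F x)\<bar>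
        = norm (LINT x|lborel. indicator \<Omega> x * (F x \<bullet> \<eta>' x))"
      using weak by simp
    have ball_int: "integrable lborel (\<lambda>x. 6 / snd p * indicator (ball (fst p) (2 * snd p)) x)" for p :: "'a \<times> real"
      by (intro integrable_mult_right integrable_real_indicator emeasure_lborel_ball_finite) auto
    have "norm (LINT x|lborel. indicator \<Omega> x * (F x \<bullet> \<eta>' x)) \<le>
        (LINT x|lborel. M * (\<Sum>p\<in>C. 6 / snd p * indicator (ball (fst p) (2 * snd p)) x))"
    proof (rule Bochner_Integration.integral_norm_bound_integral[OF weak_divergence_integrable(2)[OF \<eta>(1)]])
      show "integrable lborel (\<lambda>x. M * (\<Sum>p\<in>C. 6 / snd p * indicator (ball (fst p) (2 * snd p)) x))"
        by (intro integrable_mult_right Bochner_Integration.integrable_sum ball_int)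
      fix x :: 'a
      let ?S = "\<Sum>p\<in>C. 6 / snd p * indicator (ball (fst p) (2 * snd p)) x :: real"
      have S: "norm (\<eta>' x) \<le> ?S" using \<eta>(5)[of x] by (simp add: case_prod_beta)
      have "norm (F x \<bullet> \<eta>' x) \<le> M * ?S" if "x \<in> \<Omega>"
      proof -
        have "norm (F x \<bullet> \<eta>' x) \<le> norm (F x) * norm (\<eta>' x)" by (simp add: Cauchy_Schwarz_ineq2)
        also have "\<dots> \<le> M * ?S" using M that S by (intro mult_mono) auto
        finally show ?thesis .
      qed
      moreover have "0 \<le> M * ?S" using M(1) S norm_ge_zero[of "\<eta>' x"] by (intro mult_nonneg_nonneg) linarith+
      ultimately show "norm (indicator \<Omega> x * (F x \<bullet> \<eta>' x)) \<le> M * ?S"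
        by (simp add: indicator_def)
    qed
    also have "\<dots> = M * (\<Sum>p\<in>C. 6 / snd p * measure lborel (ball (fst p) (2 * snd p)))"
    proof -
      have "(LINT x|lborel. (\<Sum>p\<in>C. 6 / snd p * indicator (ball (fst p) (2 * snd p)) x)) =
          (\<Sum>p\<in>C. LINT x|lborel. 6 / snd p * indicator (ball (fst p) (2 * snd p)) x)"
        by (rule Bochner_Integration.integral_sum[OF ball_int])
      then show ?thesis by (simp only: integral_mult_right_zero) simp
    qed
    also have "(\<Sum>p\<in>C. 6 / snd p * measure lborel (ball (fst p) (2 * snd p)))
        = (\<Sum>p\<in>C. 6 * \<kappa> * snd p ^ (DIM('a) - 1))"
    proof (intro sum.cong refl)
      fix p assume "p \<in> C"
      then have "0 < snd p" using pos by (auto simp: case_prod_beta)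
      then show "6 / snd p * measure lborel (ball (fst p) (2 * snd p)) = 6 * \<kappa> * snd p ^ (DIM('a) - 1)"
        by (simp add: ball)
    qed
    also have "\<dots> = 6 * \<kappa> * s" by (simp add: s_def sum_distrib_left case_prod_beta)
    also have "M * (6 * \<kappa> * s) \<le> M * (6 * \<kappa> * e)"
      using C(4) \<open>\<kappa> \<ge> 0\<close> M(1) by (intro mult_left_mono) (auto simp: s_def)
    also have "\<dots> \<le> (6 * M + 1) * \<kappa> * e"
      using \<open>\<kappa> \<ge> 0\<close> e by (simp add: algebra_simps)
    finally have "norm (LINT x|lborel. indicator \<Omega> x * (F x \<bullet> \<eta>' x)) \<le> (6 * M + 1) * \<kappa> * e" .
    then have small: "\<bar>LINT x|lborel. indicator \<Omega> x * (\<eta> x * divergence F x)\<bar> \<le> (6 * M + 1) * \<kappa> * e"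
      by (simp only: flux)
    have A_sets: "A \<in> sets lborel"
      unfolding A_def using C(1) by (intro sets.finite_UN) auto
    have \<eta>_meas: "\<eta> \<in> borel_measurable lborel"
      using borel_measurable_continuous_onI[OF test_function_continuous[OF \<eta>(1)]] by simp
    have \<eta>_le: "\<forall>x. \<bar>\<eta> x\<bar> \<le> 1" using range by auto
    show "\<exists>\<eta> A. \<eta> \<in> borel_measurable lborel \<and> (\<forall>x. \<bar>\<eta> x\<bar> \<le> 1) \<and>
      A \<in> sets lborel \<and> emeasure lborel A < \<infinity> \<and> measure lborel A \<le> (6 * M + 1) * \<kappa> * e \<and> (\<forall>x. x \<notin> A \<longrightarrow> \<eta> x = 1) \<and>
      \<bar>LINT x|lborel. indicator \<Omega> x * (\<eta> x * divergence F x)\<bar> \<le> (6 * M + 1) * \<kappa> * e"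
      by (rule exI[of _ \<eta>], rule exI[of _ A])
        (intro conjI \<eta>_meas \<eta>_le A_sets A_meas emeasure_bounded_finite[OF \<open>bounded A\<close>] small far[folded A_eq])
  qed
qed

text \<open>
  Along \<open>e = (1/2)\<^sup>n\<close> the exceptional sets have summable measure, so by Borel-Cantelli the cutoffs
  tend to 1 almost everywhere and dominated convergence applies.
\<close>
lemma integral_divergence_eq_0:
  assumes "piecewise_smooth_boundary \<Omega>"
  shows "(LINT x|lborel. indicator \<Omega> x * divergence F x) = 0"
proof -
  define good where "good k e \<eta> A \<longleftrightarrow> \<eta> \<in> borel_measurable lborel \<and> (\<forall>x. \<bar>\<eta> x\<bar> \<le> 1) \<and>
    A \<in> sets lborel \<and> emeasure lborel A < \<infinity> \<and> measure lborel A \<le> k * e \<and> (\<forall>x. x \<notin> A \<longrightarrow> \<eta> x = 1) \<and>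
    \<bar>LINT x|lborel. indicator \<Omega> x * (\<eta> x * divergence F x)\<bar> \<le> k * e" for k e :: real and \<eta> and A :: "'a set"
  obtain k where k: "\<forall>e. 0 < e \<longrightarrow> e \<le> 1 \<longrightarrow> (\<exists>\<eta> A. good k e \<eta> A)"
    by (rule exE[OF cutoff_around_edges[OF assms, folded good_def]])
  define e :: "nat \<Rightarrow> real" where "e n = (1 / 2) ^ n" for n
  have "0 < e n" "e n \<le> 1" for n by (auto simp: e_def power_le_one)
  with k have "\<forall>n. \<exists>\<eta> A. good k (e n) \<eta> A" by blast
  then obtain \<eta> A where good: "\<And>n. good k (e n) (\<eta> n) (A n)" by metis
  have \<eta>: "\<eta> n \<in> borel_measurable lborel" "\<bar>\<eta> n x\<bar> \<le> 1"
    and A: "A n \<in> sets lborel" "emeasure lborel (A n) < \<infinity>" "measure lborel (A n) \<le> k * e n"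
    and \<eta>A: "x \<notin> A n \<Longrightarrow> \<eta> n x = 1"
    and small: "\<bar>LINT x|lborel. indicator \<Omega> x * (\<eta> n x * divergence F x)\<bar> \<le> k * e n" for n x
    using good[of n] unfolding good_def by simp_all
  have sum_e: "summable (\<lambda>n. k * e n)"
    unfolding e_def by (intro summable_mult summable_geometric) simp
  have "summable (\<lambda>n. measure lborel (A n))"
    by (rule summable_comparison_test'[OF sum_e, of 0]) (use A(3) in auto)
  then have "AE x in lborel. \<forall>\<^sub>F n in sequentially. x \<in> space lborel - A n"
    by (intro borel_cantelli_AE1 A)
  then have ae: "AE x in lborel. (\<lambda>n. indicator \<Omega> x * (\<eta> n x * divergence F x)) \<longlonglongrightarrow> indicator \<Omega> x * divergence F x"
  proof eventually_elim
    case (elim x)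
    then have "\<forall>\<^sub>F n in sequentially. indicator \<Omega> x * (\<eta> n x * divergence F x) = indicator \<Omega> x * divergence F x"
      by eventually_elim (simp add: \<eta>A)
    then show ?case by (rule tendsto_eventually)
  qed
  have "(\<lambda>n. LINT x|lborel. indicator \<Omega> x * (\<eta> n x * divergence F x)) \<longlonglongrightarrow> (LINT x|lborel. indicator \<Omega> x * divergence F x)"
  proof (rule integral_dominated_convergence[OF _ _ integrable_norm[OF divergence_integrable] ae])
    show "(\<lambda>x. indicator \<Omega> x * (\<eta> n x * divergence F x)) \<in> borel_measurable lborel" for n
      using borel_measurable_times[OF \<eta>(1)[of n] borel_measurable_integrable[OF divergence_integrable]]
      by (simp add: mult.left_commute)
    show "AE x in lborel. norm (indicator \<Omega> x * (\<eta> n x * divergence F x)) \<le> norm (indicator \<Omega> x * divergence F x)" for n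
      using \<eta>(2)[of n] by (intro always_eventually allI) (auto simp: indicator_def abs_mult mult_left_le_one_le)
  qed (rule borel_measurable_integrable[OF divergence_integrable])
  moreover have "(\<lambda>n. LINT x|lborel. indicator \<Omega> x * (\<eta> n x * divergence F x)) \<longlonglongrightarrow> 0"
    by (rule Lim_null_comparison[OF _ summable_LIMSEQ_zero[OF sum_e]]) (use small in auto)
  ultimately show ?thesis by (rule LIMSEQ_unique)
qed

end

section \<open>Minimum dissipation\<close>

theorem proposition4:
  fixes \<Omega> :: "(real ^ 'nd) set"
    and n b v w :: "real ^ 'nd \<Rightarrow> real ^ 'nd"
    and p \<phi> k v\<^sub>n :: "real ^ 'nd \<Rightarrow> real"
    and \<mu>\<^sub>0 \<beta>\<^sub>B \<beta>\<^sub>F \<rho> :: real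
  defines "\<alpha> \<equiv> drag \<mu>\<^sub>0 k \<beta>\<^sub>B \<beta>\<^sub>F"
  assumes domain: "open \<Omega>" "bounded \<Omega>" "piecewise_smooth_boundary \<Omega>"
    and normal: "\<forall>x\<in>smooth_boundary \<Omega>. outward_unit_normal \<Omega> x (n x)"
    and coefficients: "\<mu>\<^sub>0 > 0" "\<forall>x\<in>\<Omega>. k x > 0" "\<beta>\<^sub>F \<ge> 0"
    and regular: "regular_field \<Omega> v" "regular_field \<Omega> p" "regular_field \<Omega> \<phi>" "regular_field \<Omega> w"
    and conservative: "\<forall>x\<in>\<Omega>. \<rho> *\<^sub>R b x = grad \<phi> x"
    and solution: "darcy_forchheimer_solution \<Omega> n \<alpha> \<rho> b v\<^sub>n v p"
    and admissible: "kinematically_admissible \<Omega> n v\<^sub>n w"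
    and integrals_exist:
      "set_integrable lebesgue \<Omega> (\<lambda>x. \<alpha> (v x) (p x) x * (v x \<bullet> v x))"
      "set_integrable lebesgue \<Omega> (\<lambda>x. \<alpha> (v x) (p x) x * (w x \<bullet> w x))"
  shows "(LINT x:\<Omega>|lebesgue. \<alpha> (v x) (p x) x * (v x \<bullet> v x))
       \<le> (LINT x:\<Omega>|lebesgue. \<alpha> (v x) (p x) x * (w x \<bullet> w x))"
proof -
  define a where "a x = \<alpha> (v x) (p x) x" for x
  define q where "q x = \<phi> x - p x" for x
  define u where "u x = w x - v x" for x
  define F where "F x = q x *\<^sub>R u x" for x
  have a_nonneg: "a x \<ge> 0" if "x \<in> \<Omega>" for x
  proof -
    have "0 < k x" using coefficients that by simp
    then show ?thesis
      unfolding a_def \<alpha>_def drag_def using coefficients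
      by (intro add_nonneg_nonneg mult_nonneg_nonneg divide_nonneg_nonneg) simp_all
  qed
  have q: "regular_field \<Omega> q" and u: "regular_field \<Omega> u"
    unfolding q_def[abs_def] u_def[abs_def] by (intro regular_field_diff regular)+
  then have F: "regular_field \<Omega> F"
    unfolding F_def[abs_def] by (rule regular_field_scaleR)
  have C1: "C1_on \<Omega> v" "C1_on \<Omega> p" "C1_on \<Omega> \<phi>" "C1_on \<Omega> w" "C1_on \<Omega> q" "C1_on \<Omega> u" "C1_on \<Omega> F"
    using regular q u F by (auto simp: regular_field_def)
  have grad_q: "grad q x = a x *\<^sub>R v x" if "x \<in> \<Omega>" for x
  proof -
    have "a x *\<^sub>R v x + grad p x = grad \<phi> x"
      using solution conservative that by (auto simp: darcy_forchheimer_solution_def a_def)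
    then show ?thesis
      using grad_diff[OF C1(3,2) that] unfolding q_def[abs_def] by (metis add_diff_cancel_right')
  qed
  have div_u: "divergence u x = 0" if "x \<in> \<Omega>" for x
    using divergence_diff[OF C1(4,1) that] solution admissible that
    by (auto simp: u_def[abs_def] darcy_forchheimer_solution_def kinematically_admissible_def)
  have div_F: "divergence F x = a x * (v x \<bullet> u x)" if "x \<in> \<Omega>" for x
    using divergence_scaleR[OF C1(5,6) that] grad_q[OF that] div_u[OF that]
    by (simp add: F_def[abs_def] inner_commute)
  have int_v: "integrable lebesgue (\<lambda>x. indicator \<Omega> x * (a x * (v x \<bullet> v x)))"
    and int_w: "integrable lebesgue (\<lambda>x. indicator \<Omega> x * (a x * (w x \<bullet> w x)))"
    using integrals_exist by (simp_all add: set_integrable_def a_def)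
  \<comment> \<open>Only the functions \<open>a * (w \<bullet> w)\<close> and \<open>a * (v \<bullet> v)\<close> are known to be integrable. They dominate the
    divergence of \<open>F\<close>, because \<open>2 \<bar>v \<bullet> w\<bar> \<le> v \<bullet> v + w \<bullet> w\<close>; it is measurable since it is continuous.\<close>
  have meas_F: "(\<lambda>x. indicator \<Omega> x * divergence F x) \<in> borel_measurable lborel"
    using borel_measurable_continuous_on_indicator[OF _ continuous_on_divergence[OF C1(7)]] domain(1) by simp
  have int_F: "integrable lebesgue (\<lambda>x. indicator \<Omega> x * divergence F x)"
  proof (rule Bochner_Integration.integrable_bound)
    show "integrable lebesgue (\<lambda>x. 2 * (indicator \<Omega> x * (a x * (v x \<bullet> v x)) + indicator \<Omega> x * (a x * (w x \<bullet> w x))))"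
      by (intro integrable_mult_right Bochner_Integration.integrable_add int_v int_w)
    show "(\<lambda>x. indicator \<Omega> x * divergence F x) \<in> borel_measurable lebesgue"
      using meas_F by (rule measurable_completion)
    show "AE x in lebesgue. norm (indicator \<Omega> x * divergence F x) \<le>
      norm (2 * (indicator \<Omega> x * (a x * (v x \<bullet> v x)) + indicator \<Omega> x * (a x * (w x \<bullet> w x))))"
    proof (intro always_eventually allI)
      fix x
      have "\<bar>divergence F x\<bar> \<le> 2 * (a x * (v x \<bullet> v x) + a x * (w x \<bullet> w x))" if "x \<in> \<Omega>"
      proof -
        have "\<bar>v x \<bullet> u x\<bar> \<le> 2 * (v x \<bullet> v x + w x \<bullet> w x)"
        proof -
          have "0 \<le> v x \<bullet> v x + w x \<bullet> w x + 2 * (v x \<bullet> w x)" "0 \<le> v x \<bullet> v x + w x \<bullet> w x - 2 * (v x \<bullet> w x)"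
            using inner_ge_zero[of "v x + w x"] inner_ge_zero[of "v x - w x"]
            by (simp_all add: inner_diff inner_add inner_commute)
          moreover have "v x \<bullet> u x = v x \<bullet> w x - v x \<bullet> v x" by (simp add: u_def inner_diff_right)
          moreover have "\<bar>D\<bar> \<le> 2 * (A + B)"
            if "0 \<le> A + B + 2 * C" "0 \<le> A + B - 2 * C" "D = C - A" "0 \<le> A" "0 \<le> B" for A B C D :: real
            using that by (smt (verit))
          ultimately show ?thesis using inner_ge_zero by blast
        qed
        then have "a x * \<bar>v x \<bullet> u x\<bar> \<le> a x * (2 * (v x \<bullet> v x + w x \<bullet> w x))"
          by (intro mult_left_mono a_nonneg that)
        then show ?thesis
          using a_nonneg[OF that] by (simp add: div_F[OF that] abs_mult algebra_simps)
      qed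
      then show "norm (indicator \<Omega> x * divergence F x) \<le>
          norm (2 * (indicator \<Omega> x * (a x * (v x \<bullet> v x)) + indicator \<Omega> x * (a x * (w x \<bullet> w x))))"
        by (cases "x \<in> \<Omega>") (auto intro: order_trans[OF _ abs_ge_self])
    qed
  qed
  interpret tangential_field \<Omega> F
  proof
    show "integrable lborel (\<lambda>x. indicator \<Omega> x * divergence F x)"
      using int_F meas_F by (simp add: integrable_completion)
    fix x \<nu> assume \<nu>: "outward_unit_normal \<Omega> x \<nu>"
    then have x: "x \<in> smooth_boundary \<Omega>" by (auto simp: smooth_boundary_def)
    then have "\<nu> = n x" using outward_unit_normal_unique[OF domain(1) \<nu>] normal by blast
    then show "F x \<bullet> \<nu> = 0"
      using solution admissible x
      by (auto simp: F_def u_def inner_diff_left darcy_forchheimer_solution_def kinematically_admissible_def)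
  qed (rule domain F)+
  have "(LINT x|lebesgue. 2 * (indicator \<Omega> x * divergence F x)) = 0"
    using integral_divergence_eq_0[OF domain(3)] integral_completion[OF meas_F] by simp
  moreover have "(LINT x|lebesgue. 2 * (indicator \<Omega> x * divergence F x)) \<le>
    (LINT x|lebesgue. indicator \<Omega> x * (a x * (w x \<bullet> w x)) - indicator \<Omega> x * (a x * (v x \<bullet> v x)))"
  proof (rule integral_mono)
    show "integrable lebesgue (\<lambda>x. 2 * (indicator \<Omega> x * divergence F x))"
      by (intro integrable_mult_right int_F)
    show "integrable lebesgue (\<lambda>x. indicator \<Omega> x * (a x * (w x \<bullet> w x)) - indicator \<Omega> x * (a x * (v x \<bullet> v x)))"
      by (intro Bochner_Integration.integrable_diff int_v int_w)
    fix x
    have "2 * divergence F x \<le> a x * (w x \<bullet> w x) - a x * (v x \<bullet> v x)" if "x \<in> \<Omega>"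
    proof -
      have "0 \<le> a x * (u x \<bullet> u x)" using a_nonneg[OF that] by simp
      then show ?thesis
        by (simp add: div_F[OF that] u_def inner_diff inner_commute algebra_simps)
    qed
    then show "2 * (indicator \<Omega> x * divergence F x) \<le>
        indicator \<Omega> x * (a x * (w x \<bullet> w x)) - indicator \<Omega> x * (a x * (v x \<bullet> v x))"
      by (simp add: indicator_def)
  qed
  moreover have "(LINT x|lebesgue. indicator \<Omega> x * (a x * (w x \<bullet> w x)) - indicator \<Omega> x * (a x * (v x \<bullet> v x))) =
      (LINT x|lebesgue. indicator \<Omega> x * (a x * (w x \<bullet> w x))) - (LINT x|lebesgue. indicator \<Omega> x * (a x * (v x \<bullet> v x)))"
    by (rule Bochner_Integration.integral_diff[OF int_w int_v])
  ultimately show ?thesis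
    by (simp add: set_lebesgue_integral_def a_def)
qed

end
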